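(* (1) Let $0<\sigma<2$ and let $\mathfrak{L}$ be a class of linear integro-differential operators. If $\mathcal{L}\in\mathcal{S}^{\mathfrak{L}}$ is a linear integro-differential operator with a symmetric kernel $K$ (i.e. $K(-y)=K(y)$), then $\mathcal{L}\in\mathcal{S}^{\mathfrak{L}}_\eta$ for some $\eta\in(0,1]$. In addition, if $\mathcal{L}_\alpha$ has a symmetric kernel for all $\alpha$, then $\sup_\alpha\mathcal{L}_\alpha,\ \inf_\alpha\mathcal{L}_\alpha\in\mathcal{S}^{\mathfrak{L}}_\eta$ for $1\ge\eta>0$. (2) If $1<\sigma<2$, then $\mathcal{S}^{\mathfrak{L}_0}=\mathcal{S}^{\mathfrak{L}_0}_\eta$ for some $\eta\in(0,1]$.
   Context: $B_r(x)$ is the open ball of radius $r$, $B_r=B_r(0)$; $B(\mathbb{R}^n)$ is the set of bounded real functions on $\mathbb{R}^n$. We write $u\in C^{1,1}[x]$ if there are $v\in\mathbb{R}^n$, $r_0,M>0$ with $|u(x+y)-u(x)-v\cdot y|\le M|y|^2$ for $y\in B_{r_0}$ (then $v=\nabla u(x)$); $u\in C^{1,1}[\Omega]$ if this holds at all $x\in\Omega$ with $M$ independent of $x$. A linear integro-differential operator with positive (not necessarily symmetric) kernel $K$ is $\mathcal{L}u(x)=\mathrm{p.v.}\int_{\mathbb{R}^n}\mu(u,x,y)K(y)\,dy$, $\mu(u,x,y)=u(x+y)-u(x)-(\nabla u(x)\cdot y)\chi_{B_1}(y)$. For a class $\mathfrak{L}$ of such operators it is assumed that the supremum $K$ of all kernels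 of operators in $\mathfrak{L}$ satisfies $\int_{\mathbb{R}^n}(|y|^2\wedge1)K(y)\,dy<\infty$. In (1), the $\mathcal{L}_\alpha$ are operators of the class $\mathfrak{L}$. For fixed $0<\lambda\le\Lambda$, $\mathfrak{L}_0$ is the class of all such operators whose kernel satisfies $(2-\sigma)\lambda|y|^{-n-\sigma}\le K(y)\le(2-\sigma)\Lambda|y|^{-n-\sigma}$. Put $\mathcal{M}^+_{\mathfrak{L}}u(x)=\sup_{\mathcal{L}\in\mathfrak{L}}\mathcal{L}u(x)$ and $\mathcal{M}^-_{\mathfrak{L}}u(x)=\inf_{\mathcal{L}\in\mathfrak{L}}\mathcal{L}u(x)$. With $\mu_R(u,x,y)=u(x+y)-u(x)-(\nabla u(x)\cdot y)\chi_{B_R}(y)$, define $\mathcal{M}^{\pm}_{\mathfrak{L},R}$ in the same way, replacing $\mu$ by $\mu_R$. An operator $\mathcal{J}$ is elliptic with respect to $\mathfrak{L}$ if: (a) $\mathcal{J}u(x)$ is well-defined for $u\in C^{1,1}[x]\cap B(\mathbb{R}^n)$; (b) if $u\in C^{1,1}[\Omega]\cap B(\mathbb{R}^n)$ with $\Omega$ open then $\mathcal{J}u$ is continuous on $\Omega$; (c) $\mathcal{M}^-_{\mathfrak{L}}[u-v](x)\le\mathcal{J}u(x)-\mathcal{J}v(x)\le\mathcal{M}^+_{\mathfrak{L}}[u-v](x)$ for $u,v\in C^{1,1}[x]\cap B(\mathbb{R}^n)$. $\mathcal{S}^{\mathfrak{L}}$ is the class of operators elliptic with respect to $\mathfrak{L}$.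 For $0<\eta\le1$, $\mathcal{I}\in\mathcal{S}^{\mathfrak{L}}$ belongs to $\mathcal{S}^{\mathfrak{L}}_\eta$ if there is a constant $C$ and, for every $R\in(0,1]$, there are functions $\mathcal{B}^{\pm}_R:\mathbb{R}^n\to\mathbb{R}$ such that: (i) $\mathcal{B}^\pm_R(0)=0$ and $\mathcal{B}^\pm_R(z)=|z|\,\mathcal{B}^\pm_R(z/|z|)$ for $z\ne0$; (ii) $|\{\nu\in S^{n-1}:\mathcal{B}^\pm_R(\nu)<0\}|\ge\eta|S^{n-1}|>0$; (iii) $\mathcal{M}^-_{\mathfrak{L},R,\eta}u(x)\le\mathcal{I}u(x)-\mathcal{I}0(x)\le\mathcal{M}^+_{\mathfrak{L},R,\eta}u(x)$ whenever $u\in C^{1,1}[x]\cap B(\mathbb{R}^n)$, $x\in B_R$, where $\mathcal{M}^{\pm}_{\mathfrak{L},R,\eta}u(x)=\mathcal{M}^{\pm}_{\mathfrak{L},R}u(x)\pm\mathcal{B}^\pm_R(\nabla u(x))\pm(2-\sigma)CR^{1-\sigma}|\nabla u(x)|$. *)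

theory Defs
  imports "HOL-Analysis.Analysis"
begin

definition bounded_functions :: "((real ^ 'n) \<Rightarrow> real) set" where
  "bounded_functions = {u. u \<in> borel_measurable lebesgue \<and> bounded (range u)}"
  \<comment> \<open>Measurability is part of the notion, as these functions are integrated against kernels.\<close>

definition C11_bound :: "real \<Rightarrow> ((real ^ 'n) \<Rightarrow> real) \<Rightarrow> real ^ 'n \<Rightarrow> bool" where
  "C11_bound M u x \<longleftrightarrow> (\<exists>v. \<exists>r0>0. \<forall>y\<in>ball 0 r0. \<bar>u (x + y) - u x - v \<bullet> y\<bar> \<le> M * (norm y)\<^sup>2)"

definition C11_at :: "real ^ 'n \<Rightarrow> ((real ^ 'n) \<Rightarrow> real) set" where
  "C11_at x = {u. \<exists>M>0. C11_bound M u x}"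

definition C11_on :: "(real ^ 'n) set \<Rightarrow> ((real ^ 'n) \<Rightarrow> real) set" where
  "C11_on \<Omega> = {u. \<exists>M>0. \<forall>x\<in>\<Omega>. C11_bound M u x}"

definition grad :: "((real ^ 'n) \<Rightarrow> real) \<Rightarrow> real ^ 'n \<Rightarrow> real ^ 'n" where
  "grad u x = (THE v. GDERIV u x :> v)"

definition has_pv_integral :: "((real ^ 'n) \<Rightarrow> real) \<Rightarrow> real \<Rightarrow> bool" where
  "has_pv_integral f l \<longleftrightarrow>
     (\<forall>\<epsilon>>0. set_integrable lebesgue (- ball 0 \<epsilon>) f) \<and>
     ((\<lambda>\<epsilon>. LINT y:- ball 0 \<epsilon>|lebesgue. f y) \<longlongrightarrow> l) (at_right 0)"

text \<open>
  An operator is partial: \<^term>\<open>J u x = None\<close> means that \<open>J u\<close> is not defined at \<open>x\<close>.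
\<close>

type_synonym 'n operator = "((real ^ 'n) \<Rightarrow> real) \<Rightarrow> (real ^ 'n) \<Rightarrow> real option"

definition sup_op :: "'i set \<Rightarrow> ('i \<Rightarrow> 'n operator) \<Rightarrow> 'n operator" where
  "sup_op I J u x =
     (if (\<forall>\<alpha>\<in>I. J \<alpha> u x \<noteq> None) \<and> bdd_above ((\<lambda>\<alpha>. the (J \<alpha> u x)) ` I)
      then Some (SUP \<alpha>\<in>I. the (J \<alpha> u x)) else None)"

definition inf_op :: "'i set \<Rightarrow> ('i \<Rightarrow> 'n operator) \<Rightarrow> 'n operator" where
  "inf_op I J u x =
     (if (\<forall>\<alpha>\<in>I. J \<alpha> u x \<noteq> None) \<and> bdd_below ((\<lambda>\<alpha>. the (J \<alpha> u x)) ` I)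
      then Some (INF \<alpha>\<in>I. the (J \<alpha> u x)) else None)"

definition mu :: "real \<Rightarrow> ((real ^ 'n) \<Rightarrow> real) \<Rightarrow> real ^ 'n \<Rightarrow> real ^ 'n \<Rightarrow> real" where
  "mu R u x y = u (x + y) - u x - (grad u x \<bullet> y) * indicator (ball 0 R) y"

definition kernel :: "((real ^ 'n) \<Rightarrow> real) \<Rightarrow> bool" where
  "kernel K \<longleftrightarrow> K \<in> borel_measurable lebesgue \<and> (\<forall>y. 0 \<le> K y)"

definition symmetric_kernel :: "((real ^ 'n) \<Rightarrow> real) \<Rightarrow> bool" where
  "symmetric_kernel K \<longleftrightarrow> kernel K \<and> (\<forall>y. K (- y) = K y)"

definition lin_op_R :: "real \<Rightarrow> ((real ^ 'n) \<Rightarrow> real) \<Rightarrow> 'n operator" where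
  "lin_op_R R K u x =
     (if u differentiable (at x) \<and> (\<exists>l. has_pv_integral (\<lambda>y. mu R u x y * K y) l)
      then Some (THE l. has_pv_integral (\<lambda>y. mu R u x y * K y) l) else None)"

abbreviation lin_op :: "((real ^ 'n) \<Rightarrow> real) \<Rightarrow> 'n operator" where
  "lin_op \<equiv> lin_op_R 1"

text \<open>
  A class of linear operators is represented by the set of its kernels. The supremum of the
  kernels is taken in \<^typ>\<open>ennreal\<close>, since it may be infinite on a null set (e.g. at the origin).
\<close>

definition operator_class :: "((real ^ 'n) \<Rightarrow> real) set \<Rightarrow> bool" where
  "operator_class \<LL> \<longleftrightarrow>
     \<LL> \<noteq> {} \<and> (\<forall>K\<in>\<LL>. kernel K) \<and>
     (\<lambda>y. SUP K\<in>\<LL>. ennreal (K y)) \<in> borel_measurable lebesgue \<and>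
     (\<integral>\<^sup>+y. ennreal (min ((norm y)\<^sup>2) 1) * (SUP K\<in>\<LL>. ennreal (K y)) \<partial>lebesgue) < \<infinity>"

definition class_L0 :: "real \<Rightarrow> real \<Rightarrow> real \<Rightarrow> ((real ^ 'n) \<Rightarrow> real) set" where
  "class_L0 lam Lam \<sigma> =
     {K. kernel K \<and>
         (\<forall>y. y \<noteq> 0 \<longrightarrow>
            (2 - \<sigma>) * lam * norm y powr (- real CARD('n) - \<sigma>) \<le> K y \<and>
            K y \<le> (2 - \<sigma>) * Lam * norm y powr (- real CARD('n) - \<sigma>))}"

definition M_plus :: "((real ^ 'n) \<Rightarrow> real) set \<Rightarrow> real \<Rightarrow> 'n operator" where
  "M_plus \<LL> R = sup_op \<LL> (lin_op_R R)"

definition M_minus :: "((real ^ 'n) \<Rightarrow> real) set \<Rightarrow> real \<Rightarrow> 'n operator" where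
  "M_minus \<LL> R = inf_op \<LL> (lin_op_R R)"

text \<open>
  If \<open>u \<in> C11_at x \<inter> bounded_functions\<close> and \<open>\<LL>\<close> is an \<^const>\<open>operator_class\<close>, then
  \<open>M_plus \<LL> R u x\<close> and \<open>M_minus \<LL> R u x\<close> are defined for \<open>0 < R \<le> 1\<close>; below, \<^const>\<open>the\<close> is
  applied only in this situation or to values required to be defined.
\<close>

definition elliptic_ops :: "((real ^ 'n) \<Rightarrow> real) set \<Rightarrow> 'n operator set" where
  "elliptic_ops \<LL> =
     {J. (\<forall>x. \<forall>u \<in> C11_at x \<inter> bounded_functions. J u x \<noteq> None) \<and>
         (\<forall>\<Omega>. open \<Omega> \<longrightarrow>
            (\<forall>u \<in> C11_on \<Omega> \<inter> bounded_functions. continuous_on \<Omega> (\<lambda>x. the (J u x)))) \<and>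
         (\<forall>x. \<forall>u \<in> C11_at x \<inter> bounded_functions. \<forall>v \<in> C11_at x \<inter> bounded_functions.
            the (M_minus \<LL> 1 (\<lambda>z. u z - v z) x) \<le> the (J u x) - the (J v x) \<and>
            the (J u x) - the (J v x) \<le> the (M_plus \<LL> 1 (\<lambda>z. u z - v z) x))}"

text \<open>
  Surface measure of a subset of the unit sphere, by integration in polar coordinates: \<open>n\<close> times
  the volume of the cone over the set (the counting measure if \<open>n = 1\<close>). It is \<open>0\<close> on sets that
  are not measurable.
\<close>

definition sphere_measure :: "(real ^ 'n) set \<Rightarrow> real" where
  "sphere_measure A =
     real CARD('n) * measure lebesgue {t *\<^sub>R \<nu> | t \<nu>. 0 < t \<and> t \<le> 1 \<and> \<nu> \<in> A}"

definition drift_fun :: "real \<Rightarrow> ((real ^ 'n) \<Rightarrow> real) \<Rightarrow> bool" where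
  "drift_fun \<eta> B \<longleftrightarrow>
     B 0 = 0 \<and> (\<forall>z. z \<noteq> 0 \<longrightarrow> B z = norm z * B (z /\<^sub>R norm z)) \<and>
     sphere_measure {\<nu> \<in> sphere 0 1. B \<nu> < 0} \<ge> \<eta> * sphere_measure (sphere 0 1 :: (real ^ 'n) set) \<and>
     \<eta> * sphere_measure (sphere 0 1 :: (real ^ 'n) set) > 0"

definition elliptic_ops_eta ::
    "real \<Rightarrow> ((real ^ 'n) \<Rightarrow> real) set \<Rightarrow> real \<Rightarrow> 'n operator set" where
  "elliptic_ops_eta \<sigma> \<LL> \<eta> =
     {J \<in> elliptic_ops \<LL>.
        \<exists>C. \<forall>R. 0 < R \<and> R \<le> 1 \<longrightarrow>
          (\<exists>Bp Bm. drift_fun \<eta> Bp \<and> drift_fun \<eta> Bm \<and>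
             (\<forall>x \<in> ball 0 R. \<forall>u \<in> C11_at x \<inter> bounded_functions.
                the (M_minus \<LL> R u x) - Bm (grad u x)
                    - (2 - \<sigma>) * C * R powr (1 - \<sigma>) * norm (grad u x)
                  \<le> the (J u x) - the (J (\<lambda>_. 0) x) \<and>
                the (J u x) - the (J (\<lambda>_. 0) x)
                  \<le> the (M_plus \<LL> R u x) + Bp (grad u x)
                    + (2 - \<sigma>) * C * R powr (1 - \<sigma>) * norm (grad u x)))}"

end

theory Submission
  imports Defs
begin

text \<open>
  The proof compares \<open>\<M>\<^sup>\<plusminus>\<close> with cutoff radius \<open>R\<close> to \<open>\<M>\<^sup>\<plusminus>\<close> with cutoff radius \<open>1\<close> by
  changing the function instead of the operator. Given \<open>u\<close> with gradient \<open>p\<close> at \<open>x\<close>, add to \<open>u\<close> the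
  function \<open>\<phi>(x + y) = p \<bullet> y\<close> supported on the annulus \<open>R \<le> |y| < 1\<close>. The sum \<open>w = u + \<phi>\<close> is still
  bounded and still of class \<open>C\<^sup>1\<^sup>,\<^sup>1\<close> at \<open>x\<close> with gradient \<open>p\<close>, because \<open>\<phi>\<close> vanishes near \<open>x\<close>, and
  \<open>\<mu>\<^sub>1(w, x, y) = \<mu>\<^sub>R(u, x, y)\<close>. Hence \<open>\<M>\<^sup>\<plusminus>\<^sub>1 w(x) = \<M>\<^sup>\<plusminus>\<^sub>R u(x)\<close> (lemma \<open>M_retruncated\<close>), and
  ellipticity of \<open>J\<close>, applied to \<open>w\<close> and \<open>0\<close>, gives
  \<open>\<M>\<^sup>-\<^sub>R u(x) \<le> J w(x) - J 0(x) \<le> \<M>\<^sup>+\<^sub>R u(x)\<close>. What remains is to bound \<open>J u(x) - J w(x)\<close>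
  by \<open>(2 - \<sigma>) A R\<^sup>1\<^sup>-\<^sup>\<sigma> |p|\<close>. Such a bound suffices (lemma \<open>elliptic_ops_etaI\<close>): with
  \<open>B(z) = - (2 - \<sigma>) R\<^sup>1\<^sup>-\<^sup>\<sigma> |z|\<close>, which is negative on the whole sphere, and \<open>C = A + 1\<close>, the drift
  terms add up to exactly this bound, so every \<open>\<eta> \<in> (0, 1]\<close> is admissible.
  
  For a symmetric kernel \<open>K\<close> the difference \<open>J u(x) - J w(x)\<close> is the integral of the odd function
  \<open>- (p \<bullet> y) K(y)\<close> over the annulus, so \<open>A = 0\<close>; this passes to suprema and infima of such operators.
  For \<open>\<LL>\<^sub>0\<close> and \<open>\<sigma> > 1\<close>, ellipticity bounds the difference by the extremal operators evaluated at
  \<open>u - w = - \<phi>\<close>, that is, by integrals of \<open>|p| |y| K(y)\<close> over the annulus. Since \<open>K\<close> is at most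
  \<open>(2 - \<sigma>) \<Lambda> |y|\<^sup>-\<^sup>n\<^sup>-\<^sup>\<sigma>\<close>, a sum over dyadic shells gives \<open>O(R\<^sup>1\<^sup>-\<^sup>\<sigma>)\<close>.
  
  The other half of the work is that suprema and infima of operators of the class are elliptic at
  all. Each operator is dominated by the supremum \<open>H\<close> of the kernels, so \<open>\<L>\<^sub>\<alpha> u(x') - \<L>\<^sub>\<alpha> u(x)\<close> is
  bounded, uniformly in \<open>\<alpha>\<close>, by the \<open>H\<close>-weighted \<open>L\<^sup>1\<close> distance of \<open>\<mu>\<^sub>1(u, x', \<cdot>)\<close> and
  \<open>\<mu>\<^sub>1(u, x, \<cdot>)\<close>. This distance tends to \<open>0\<close> as \<open>x' \<rightarrow> x\<close> (lemma \<open>mu_weighted_L1_continuous\<close>). Away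
  from the origin this is continuity of translations in a weighted \<open>L\<^sup>1\<close> space, as \<open>u\<close> is merely
  bounded and measurable there. Near the origin it needs the quadratic expansion on a ball whose
  radius does not shrink as \<open>x'\<close> varies; the definition of \<open>C\<^sup>1\<^sup>,\<^sup>1[\<Omega>]\<close> lets the radius depend on the
  point, and lemma \<open>C11_convex_expansion\<close> removes this dependence by a convexity argument.
\<close>

section \<open>Pointwise second-order expansions\<close>

lemma C11_expansion_GDERIV:
  fixes u :: "real ^ 'n \<Rightarrow> real"
  assumes "0 < r" and bd: "\<And>y. norm y < r \<Longrightarrow> \<bar>u (x + y) - u x - v \<bullet> y\<bar> \<le> M * (norm y)\<^sup>2"
  shows "GDERIV u x :> v"
proof -
  have lim: "((\<lambda>y. M * norm y) \<longlongrightarrow> 0) (at (0 :: real ^ 'n))"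
    by (auto intro!: tendsto_eq_intros)
  have "((\<lambda>y. norm (u (x + y) - u x - y \<bullet> v) / norm y) \<longlongrightarrow> 0) (at 0)"
  proof (rule Lim_null_comparison[OF _ lim])
    show "\<forall>\<^sub>F y in at 0. norm (norm (u (x + y) - u x - y \<bullet> v) / norm y) \<le> M * norm y"
      unfolding eventually_at
    proof (intro exI[of _ r] conjI ballI impI)
      fix y :: "real ^ 'n" assume "y \<noteq> 0 \<and> dist y 0 < r"
      then have "norm (u (x + y) - u x - y \<bullet> v) \<le> (M * norm y) * norm y" and "y \<noteq> 0"
        using bd[of y] by (auto simp: inner_commute power2_eq_square mult.assoc)
      then show "norm (norm (u (x + y) - u x - y \<bullet> v) / norm y) \<le> M * norm y"
        by (simp add: divide_le_eq)
    qed fact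
  qed
  then show ?thesis
    unfolding gderiv_def has_derivative_at by (auto intro: bounded_linear_inner_left)
qed

lemma GDERIV_grad:
  fixes u :: "real ^ 'n \<Rightarrow> real"
  assumes "GDERIV u x :> v"
  shows "grad u x = v"
  unfolding grad_def
proof (rule the_equality)
  show "GDERIV u x :> v" by fact
  fix w assume "GDERIV u x :> w"
  with assms have "(\<lambda>h. h \<bullet> w) = (\<lambda>h. h \<bullet> v)"
    unfolding gderiv_def by (rule has_derivative_unique[rotated])
  then show "w = v" by (metis inner_commute vector_eq_rdot)
qed

lemma C11_boundD:
  fixes u :: "real ^ 'n \<Rightarrow> real"
  assumes "C11_bound M u x"
  shows "GDERIV u x :> grad u x"
    and "\<exists>r>0. \<forall>y. norm y < r \<longrightarrow> \<bar>u (x + y) - u x - grad u x \<bullet> y\<bar> \<le> M * (norm y)\<^sup>2"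
proof -
  obtain v r where r: "0 < r"
      and bd: "\<And>y. norm y < r \<Longrightarrow> \<bar>u (x + y) - u x - v \<bullet> y\<bar> \<le> M * (norm y)\<^sup>2"
    using assms unfolding C11_bound_def by fastforce
  have "GDERIV u x :> v" by (rule C11_expansion_GDERIV[OF r bd])
  moreover from this have "grad u x = v" by (rule GDERIV_grad)
  ultimately show "GDERIV u x :> grad u x"
    and "\<exists>r>0. \<forall>y. norm y < r \<longrightarrow> \<bar>u (x + y) - u x - grad u x \<bullet> y\<bar> \<le> M * (norm y)\<^sup>2"
    using r bd by auto
qed

lemma C11_atD:
  fixes u :: "real ^ 'n \<Rightarrow> real"
  assumes "u \<in> C11_at x"
  obtains M r where "0 < M" "0 < r" "r \<le> 1"
    "\<And>y. norm y < r \<Longrightarrow> \<bar>u (x + y) - u x - grad u x \<bullet> y\<bar> \<le> M * (norm y)\<^sup>2"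
proof -
  obtain M where M: "0 < M" "C11_bound M u x"
    using assms by (auto simp: C11_at_def)
  obtain r where r: "0 < r"
      "\<And>y. norm y < r \<Longrightarrow> \<bar>u (x + y) - u x - grad u x \<bullet> y\<bar> \<le> M * (norm y)\<^sup>2"
    using C11_boundD(2)[OF M(2)] by auto
  show thesis
    by (rule that[of M "min r 1"]) (use M r in auto)
qed

lemma C11_atI:
  fixes u :: "real ^ 'n \<Rightarrow> real"
  assumes "0 < r" and bd: "\<And>y. norm y < r \<Longrightarrow> \<bar>u (x + y) - u x - v \<bullet> y\<bar> \<le> M * (norm y)\<^sup>2"
  shows "u \<in> C11_at x" and "grad u x = v"
proof -
  have "C11_bound (max M 1) u x"
    unfolding C11_bound_def
  proof (intro exI conjI ballI)
    fix y :: "real ^ 'n" assume "y \<in> ball 0 r"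
    then have "\<bar>u (x + y) - u x - v \<bullet> y\<bar> \<le> M * (norm y)\<^sup>2" by (intro bd) simp
    also have "\<dots> \<le> max M 1 * (norm y)\<^sup>2" by (intro mult_right_mono) auto
    finally show "\<bar>u (x + y) - u x - v \<bullet> y\<bar> \<le> max M 1 * (norm y)\<^sup>2" .
  qed fact
  then show "u \<in> C11_at x"
    unfolding C11_at_def by (auto intro!: exI[of _ "max M 1"])
  show "grad u x = v"
    by (rule GDERIV_grad[OF C11_expansion_GDERIV[OF assms]])
qed

lemma C11_at_GDERIV: "u \<in> C11_at x \<Longrightarrow> GDERIV u x :> grad u x"
  unfolding C11_at_def using C11_boundD(1) by auto

lemma C11_at_differentiable: "u \<in> C11_at x \<Longrightarrow> u differentiable (at x)"
  using C11_at_GDERIV unfolding gderiv_def differentiable_def by blast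

lemma C11_on_at: "u \<in> C11_on \<Omega> \<Longrightarrow> x \<in> \<Omega> \<Longrightarrow> u \<in> C11_at x"
  by (auto simp: C11_on_def C11_at_def)

lemma C11_at_lincomb:
  fixes u v :: "real ^ 'n \<Rightarrow> real"
  assumes "u \<in> C11_at x" "v \<in> C11_at x"
  shows "(\<lambda>z. u z + c * v z) \<in> C11_at x"
    and "grad (\<lambda>z. u z + c * v z) x = grad u x + c *\<^sub>R grad v x"
proof -
  obtain M r where u: "0 < M" "0 < r" "r \<le> 1"
    "\<And>y. norm y < r \<Longrightarrow> \<bar>u (x + y) - u x - grad u x \<bullet> y\<bar> \<le> M * (norm y)\<^sup>2"
    using C11_atD[OF assms(1)] by blast
  obtain N s where v: "0 < N" "0 < s" "s \<le> 1"
    "\<And>y. norm y < s \<Longrightarrow> \<bar>v (x + y) - v x - grad v x \<bullet> y\<bar> \<le> N * (norm y)\<^sup>2"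
    using C11_atD[OF assms(2)] by blast
  have "\<bar>(u (x + y) + c * v (x + y)) - (u x + c * v x) - (grad u x + c *\<^sub>R grad v x) \<bullet> y\<bar>
      \<le> (M + \<bar>c\<bar> * N) * (norm y)\<^sup>2" if "norm y < min r s" for y
  proof -
    have "\<bar>(u (x + y) + c * v (x + y)) - (u x + c * v x) - (grad u x + c *\<^sub>R grad v x) \<bullet> y\<bar>
        = \<bar>(u (x + y) - u x - grad u x \<bullet> y) + c * (v (x + y) - v x - grad v x \<bullet> y)\<bar>"
      by (simp add: algebra_simps)
    also have "\<dots> \<le> \<bar>u (x + y) - u x - grad u x \<bullet> y\<bar> + \<bar>c\<bar> * \<bar>v (x + y) - v x - grad v x \<bullet> y\<bar>"
      by (metis abs_mult abs_triangle_ineq)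
    also have "\<dots> \<le> M * (norm y)\<^sup>2 + \<bar>c\<bar> * (N * (norm y)\<^sup>2)"
      using that u(4)[of y] v(4)[of y] by (intro add_mono mult_left_mono) auto
    finally show ?thesis by (simp add: algebra_simps)
  qed
  note expansion = this
  have "0 < min r s" using u v by simp
  show "(\<lambda>z. u z + c * v z) \<in> C11_at x"
    and "grad (\<lambda>z. u z + c * v z) x = grad u x + c *\<^sub>R grad v x"
    by (rule C11_atI[OF \<open>0 < min r s\<close> expansion]; assumption)+
qed

lemma C11_at_diff:
  fixes u v :: "real ^ 'n \<Rightarrow> real"
  assumes "u \<in> C11_at x" "v \<in> C11_at x"
  shows "(\<lambda>z. u z - v z) \<in> C11_at x" and "grad (\<lambda>z. u z - v z) x = grad u x - grad v x"
  using C11_at_lincomb[OF assms, of "-1"] by simp_all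

lemma C11_at_const:
  fixes x :: "real ^ 'n"
  shows "(\<lambda>_. c) \<in> C11_at x"
  by (rule C11_atI(1)[of 1 _ _ 0 1]) auto

section \<open>Uniformity of the expansion on convex sets\<close>

text \<open>
  At every point the graph of \<open>f\<close> lies locally strictly above its tangent. If \<open>f 1\<close> were below the
  tangent at \<open>0\<close>, then \<open>f\<close> minus its chord would be positive somewhere and so have an interior
  maximum; there its derivative vanishes, and the strict support line rules a maximum out. This is
  the step from local to global, however fast the neighbourhoods shrink from point to point.
\<close>

lemma strict_local_support_ge:
  fixes f f' :: "real \<Rightarrow> real"
  assumes deriv: "\<And>t. 0 \<le> t \<Longrightarrow> t \<le> 1 \<Longrightarrow> (f has_real_derivative f' t) (at t)"
    and supp: "\<And>t. 0 \<le> t \<Longrightarrow> t \<le> 1 \<Longrightarrow>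
      \<exists>d>0. \<forall>s. 0 < \<bar>s - t\<bar> \<and> \<bar>s - t\<bar> < d \<longrightarrow> f t + f' t * (s - t) < f s"
  shows "f 0 + f' 0 \<le> f 1"
proof (rule ccontr)
  assume neg: "\<not> f 0 + f' 0 \<le> f 1"
  define g where "g t = f t - f 0 - (f 1 - f 0) * t" for t
  define g' where "g' t = f' t - (f 1 - f 0)" for t
  have g01: "g 0 = 0" "g 1 = 0" by (auto simp: g_def)
  have g'0: "g' 0 > 0" using neg by (simp add: g'_def)
  have dg: "(g has_real_derivative g' t) (at t)" if "0 \<le> t" "t \<le> 1" for t
    unfolding g_def g'_def by (auto intro!: derivative_eq_intros deriv that)
  have sg: "\<exists>d>0. \<forall>s. 0 < \<bar>s - t\<bar> \<and> \<bar>s - t\<bar> < d \<longrightarrow> g t + g' t * (s - t) < g s"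
    if "0 \<le> t" "t \<le> 1" for t
    using supp[OF that] by (simp add: g_def g'_def algebra_simps)
  have "continuous_on {0..1} g"
    by (intro continuous_at_imp_continuous_on ballI DERIV_isCont[OF dg]) auto
  then obtain m where m: "m \<in> {0..1}" and mx: "\<And>t. t \<in> {0..1} \<Longrightarrow> g t \<le> g m"
    using continuous_attains_sup[of "{0..1::real}" g] by auto
  \<comment> \<open>The slope of \<open>g\<close> at \<open>0\<close> is positive, so \<open>g\<close> is positive just to the right of \<open>0\<close>.\<close>
  obtain d where "0 < d" and d: "\<And>s. 0 < \<bar>s\<bar> \<and> \<bar>s\<bar> < d \<Longrightarrow> g' 0 * s < g s"
    using sg[of 0] g01 by auto
  define e where "e = min (d / 2) 1"
  have "0 < g' 0 * e" using g'0 \<open>0 < d\<close> by (simp add: e_def)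
  also have "\<dots> < g e" using d[of e] \<open>0 < d\<close> by (auto simp: e_def)
  also have "\<dots> \<le> g m" using \<open>0 < d\<close> by (intro mx) (auto simp: e_def)
  finally have "0 < g m" .
  then have m01: "0 < m" "m < 1" using m g01 by (auto simp: less_le)
  have "g' m = 0"
  proof (rule DERIV_local_max[OF dg])
    show "0 < min m (1 - m)" using m01 by simp
    show "\<forall>y. \<bar>m - y\<bar> < min m (1 - m) \<longrightarrow> g y \<le> g m" by (auto intro!: mx)
  qed (use m01 in auto)
  moreover obtain c where "0 < c" and c: "\<And>s. 0 < \<bar>s - m\<bar> \<and> \<bar>s - m\<bar> < c \<Longrightarrow> g m + g' m * (s - m) < g s"
    using sg[of m] m01 by auto
  define s where "s = m + min (c / 2) (1 - m)"
  have "g m + g' m * (s - m) < g s" using \<open>0 < c\<close> m01 by (intro c) (auto simp: s_def)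
  moreover have "g s \<le> g m" using \<open>0 < c\<close> m01 by (intro mx) (auto simp: s_def)
  ultimately show False by simp
qed

text \<open>
  Adding a slightly larger parabola than the one in the \<open>C\<^sup>1\<^sup>,\<^sup>1\<close> bound, with constant \<open>M + 1\<close>, makes \<open>u\<close>
  strictly convex in the local sense of \<open>strict_local_support_ge\<close> along every segment in \<open>S\<close>.
\<close>

lemma C11_convex_lower:
  fixes u :: "real ^ 'n \<Rightarrow> real"
  assumes S: "convex S" "x \<in> S" "x + y \<in> S"
    and M: "\<And>z. z \<in> S \<Longrightarrow> C11_bound M u z"
  shows "u x + grad u x \<bullet> y - (M + 1) * (norm y)\<^sup>2 \<le> u (x + y)"
proof (cases "y = 0")
  case False
  have seg: "x + t *\<^sub>R y \<in> S" if "0 \<le> t" "t \<le> 1" for t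
  proof -
    have "(1 - t) *\<^sub>R x + t *\<^sub>R (x + y) \<in> S" using convexD_alt[OF S that] .
    then show ?thesis by (simp add: algebra_simps)
  qed
  define c where "c = (M + 1) * (norm y)\<^sup>2"
  define f where "f t = u (x + t *\<^sub>R y) + c * t\<^sup>2" for t
  define f' where "f' t = grad u (x + t *\<^sub>R y) \<bullet> y + 2 * c * t" for t
  have "f 0 + f' 0 \<le> f 1"
  proof (rule strict_local_support_ge)
    fix t :: real assume t: "0 \<le> t" "t \<le> 1"
    have g: "(u has_derivative (\<lambda>h. h \<bullet> grad u (x + t *\<^sub>R y))) (at (x + t *\<^sub>R y))"
      using C11_boundD(1)[OF M[OF seg[OF t]]] by (simp add: gderiv_def)
    have "((\<lambda>t. u (x + t *\<^sub>R y)) has_derivative (\<lambda>s. (s *\<^sub>R y) \<bullet> grad u (x + t *\<^sub>R y))) (at t)"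
      by (rule has_derivative_compose[where g = u]) (use g in \<open>auto intro!: derivative_eq_intros\<close>)
    then have "((\<lambda>t. u (x + t *\<^sub>R y)) has_real_derivative grad u (x + t *\<^sub>R y) \<bullet> y) (at t)"
      by (simp add: has_field_derivative_def inner_commute mult.commute[of "inner _ _"] mult_commute_abs)
    then show "(f has_real_derivative f' t) (at t)"
      unfolding f_def f'_def by (auto intro!: derivative_eq_intros)
    obtain r where r: "0 < r" "\<And>h. norm h < r \<Longrightarrow>
        \<bar>u (x + t *\<^sub>R y + h) - u (x + t *\<^sub>R y) - grad u (x + t *\<^sub>R y) \<bullet> h\<bar> \<le> M * (norm h)\<^sup>2"
      using C11_boundD(2)[OF M[OF seg[OF t]]] by auto
    show "\<exists>d>0. \<forall>s. 0 < \<bar>s - t\<bar> \<and> \<bar>s - t\<bar> < d \<longrightarrow> f t + f' t * (s - t) < f s"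
    proof (intro exI[of _ "r / norm y"] conjI allI impI)
      show "0 < r / norm y" using r False by simp
      fix s assume s: "0 < \<bar>s - t\<bar> \<and> \<bar>s - t\<bar> < r / norm y"
      define h where "h = (s - t) *\<^sub>R y"
      have "norm h = \<bar>s - t\<bar> * norm y" by (simp add: h_def)
      then have nh: "norm h = \<bar>s - t\<bar> * norm y" and "norm h < r"
        using s False by (simp_all add: field_simps)
      have eq: "x + t *\<^sub>R y + h = x + s *\<^sub>R y" by (simp add: h_def algebra_simps)
      from \<open>norm h < r\<close> have "u (x + t *\<^sub>R y) + grad u (x + t *\<^sub>R y) \<bullet> h - M * (norm h)\<^sup>2 \<le> u (x + s *\<^sub>R y)"
        using r(2)[of h] unfolding eq by (auto simp: abs_le_iff)
      moreover have "M * (norm h)\<^sup>2 < c * (s - t)\<^sup>2"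
        using s False by (simp add: nh c_def power_mult_distrib algebra_simps)
      moreover have "grad u (x + t *\<^sub>R y) \<bullet> h = (grad u (x + t *\<^sub>R y) \<bullet> y) * (s - t)"
        by (simp add: h_def)
      ultimately show "f t + f' t * (s - t) < f s"
        unfolding f_def f'_def by (simp add: algebra_simps power2_eq_square)
    qed
  qed
  then show ?thesis by (simp add: f_def f'_def c_def)
qed simp

lemma C11_bound_minus:
  fixes u :: "real ^ 'n \<Rightarrow> real"
  assumes "C11_bound M u x"
  shows "C11_bound M (\<lambda>z. - u z) x" and "grad (\<lambda>z. - u z) x = - grad u x"
proof -
  obtain r where r: "0 < r" "\<And>y. norm y < r \<Longrightarrow> \<bar>u (x + y) - u x - grad u x \<bullet> y\<bar> \<le> M * (norm y)\<^sup>2"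
    using C11_boundD(2)[OF assms] by auto
  then have *: "\<bar>- u (x + y) - (- u x) - (- grad u x) \<bullet> y\<bar> \<le> M * (norm y)\<^sup>2" if "norm y < r" for y
    using r(2)[OF that] by simp
  show "C11_bound M (\<lambda>z. - u z) x"
    unfolding C11_bound_def using r(1) * by (intro exI[of _ "- grad u x"] exI[of _ r]) auto
  show "grad (\<lambda>z. - u z) x = - grad u x"
    by (rule C11_atI(2)[OF r(1) *])
qed

text \<open>
  The radius of validity in \<open>C11_bound\<close> may depend on the point. On a convex set it
  can be dropped at the price of a larger constant.
\<close>

lemma C11_convex_expansion:
  fixes u :: "real ^ 'n \<Rightarrow> real"
  assumes S: "convex S" "x \<in> S" "x + y \<in> S"
    and M: "\<And>z. z \<in> S \<Longrightarrow> C11_bound M u z"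
  shows "\<bar>u (x + y) - u x - grad u x \<bullet> y\<bar> \<le> (M + 1) * (norm y)\<^sup>2"
  using C11_convex_lower[OF S M] C11_convex_lower[OF S, of M "\<lambda>z. - u z"]
    C11_bound_minus[OF M] C11_bound_minus(2)[OF M[OF S(2)]]
  by (simp add: abs_le_iff)

text \<open>
  The value of \<open>u\<close> at \<open>x' + y\<close> is predicted both by the expansion at \<open>x'\<close> and by the one at \<open>x\<close>. The two
  predictions differ by the difference of the gradients times \<open>y\<close>, up to quadratic errors; take \<open>y\<close> of
  length \<open>|x' - x|\<close> in the direction of that difference.
\<close>

lemma C11_grad_Lipschitz:
  fixes u :: "real ^ 'n \<Rightarrow> real"
  assumes M: "\<And>z. z \<in> ball x r \<Longrightarrow> C11_bound M u z" and "0 \<le> M"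
    and x': "norm (x' - x) < r / 2"
  shows "norm (grad u x' - grad u x) \<le> 6 * (M + 1) * norm (x' - x)"
proof (cases "grad u x' = grad u x \<or> x' = x")
  case True then show ?thesis using \<open>0 \<le> M\<close> by auto
next
  case False
  define d where "d = grad u x' - grad u x"
  define h where "h = norm (x' - x)"
  define y where "y = (h / norm d) *\<^sub>R d"
  have pos: "0 < h" "0 < norm d" using False by (auto simp: h_def d_def)
  have ny: "norm y = h" using pos by (simp add: y_def)
  have nb: "norm ((x' - x) + y) \<le> 2 * h" using norm_triangle_ineq[of "x' - x" y] ny by (simp add: h_def)
  have "0 < r" using x' norm_ge_zero[of "x' - x"] by linarith
  have mem: "x \<in> ball x r" "x' \<in> ball x r" "x' + y \<in> ball x r"
  proof -
    show "x \<in> ball x r" using \<open>0 < r\<close> by simp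
    show "x' \<in> ball x r" using x' \<open>0 < r\<close> by (simp add: dist_norm norm_minus_commute)
    have "dist x (x' + y) = norm ((x' - x) + y)" by (simp add: dist_norm norm_minus_commute algebra_simps)
    then show "x' + y \<in> ball x r" using nb x' by (simp add: h_def)
  qed
  have e1: "\<bar>u (x' + y) - u x' - grad u x' \<bullet> y\<bar> \<le> (M + 1) * h\<^sup>2"
    using C11_convex_expansion[OF convex_ball mem(2,3) M] ny by simp
  have e2: "\<bar>u x' - u x - grad u x \<bullet> (x' - x)\<bar> \<le> (M + 1) * h\<^sup>2"
    using C11_convex_expansion[OF convex_ball mem(1) _ M, of "x' - x"] mem by (simp add: h_def)
  have "\<bar>u (x' + y) - u x - grad u x \<bullet> ((x' - x) + y)\<bar> \<le> (M + 1) * (norm ((x' - x) + y))\<^sup>2"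
    using C11_convex_expansion[OF convex_ball mem(1) _ M, of "(x' - x) + y"] mem
    by (simp add: algebra_simps)
  also have "\<dots> \<le> (M + 1) * (2 * h)\<^sup>2"
    using nb \<open>0 \<le> M\<close> by (intro mult_left_mono power_mono) auto
  finally have e3: "\<bar>u (x' + y) - u x - grad u x \<bullet> ((x' - x) + y)\<bar> \<le> 4 * (M + 1) * h\<^sup>2"
    by (simp add: power_mult_distrib algebra_simps)
  have "norm d * h = d \<bullet> y"
    using pos by (simp add: y_def dot_square_norm power2_eq_square)
  also have "\<dots> \<le> 6 * (M + 1) * h\<^sup>2"
    using e1 e2 e3 by (simp add: d_def inner_diff_left inner_add_right algebra_simps abs_le_iff)
  finally have "norm d * h \<le> (6 * (M + 1) * h) * h" by (simp add: power2_eq_square)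
  then show ?thesis using pos by (simp add: d_def h_def)
qed

section \<open>Linear operators with a dominated kernel\<close>

lemma lebesgue_measurable_translation [measurable]:
  "(\<lambda>y. x + y) \<in> lebesgue \<rightarrow>\<^sub>M (lebesgue :: 'a::euclidean_space measure)"
  using lebesgue_affine_measurable[of "\<lambda>_. 1" x] by (simp add: euclidean_representation)

lemma distr_lebesgue_translation:
  "distr lebesgue lebesgue (\<lambda>y. x + y) = (lebesgue :: 'a::euclidean_space measure)"
  using lebesgue_affine_euclidean[of "\<lambda>_. 1" x]
  by (simp add: euclidean_representation density_1)

lemma lebesgue_measurable_uminus [measurable]:
  "uminus \<in> lebesgue \<rightarrow>\<^sub>M (lebesgue :: 'a::euclidean_space measure)"
  using lebesgue_affine_measurable[of "\<lambda>_. -1" 0]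
  by (simp add: euclidean_representation sum_negf)

lemma distr_lebesgue_uminus:
  "distr lebesgue lebesgue uminus = (lebesgue :: 'a::euclidean_space measure)"
  using lebesgue_affine_euclidean[of "\<lambda>_. -1" 0, symmetric]
  by (simp add: euclidean_representation sum_negf density_1)

lemma integral_lebesgue_odd:
  fixes f :: "'a::euclidean_space \<Rightarrow> real"
  assumes [measurable]: "f \<in> borel_measurable lebesgue" and odd: "\<And>y. f (- y) = - f y"
  shows "integral\<^sup>L lebesgue f = 0"
proof -
  have "integral\<^sup>L lebesgue f = integral\<^sup>L (distr lebesgue lebesgue uminus) f"
    by (simp add: distr_lebesgue_uminus)
  also have "\<dots> = (\<integral>y. f (- y) \<partial>lebesgue)"
    by (rule integral_distr) auto
  also have "\<dots> = - integral\<^sup>L lebesgue f"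
    by (simp add: odd)
  finally show ?thesis by simp
qed

lemma borel_measurable_lebesgueI:
  "f \<in> borel_measurable borel \<Longrightarrow> f \<in> borel_measurable lebesgue"
  by (intro measurable_completion) simp

definition trunc_sq :: "real ^ 'n \<Rightarrow> real" where
  "trunc_sq y = min ((norm y)\<^sup>2) 1"

lemma trunc_sq_nonneg: "0 \<le> trunc_sq y"
  by (simp add: trunc_sq_def)

lemma trunc_sq_measurable [measurable]: "trunc_sq \<in> borel_measurable lebesgue"
  unfolding trunc_sq_def by (intro borel_measurable_lebesgueI) measurable

lemma trunc_sq_lower:
  assumes "0 < r" "r \<le> 1" "r \<le> norm y"
  shows "r\<^sup>2 \<le> trunc_sq y"
  using assms power_mono[of r "norm y" 2] power_le_one[of r 2] by (simp add: trunc_sq_def)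

text \<open>
  The supremum of the kernels of a class is only finite almost everywhere. A real-valued
  representative therefore dominates the kernels almost everywhere, which is all that integration
  sees.
\<close>

definition dominating_kernel :: "(real ^ 'n \<Rightarrow> real) set \<Rightarrow> (real ^ 'n \<Rightarrow> real) \<Rightarrow> bool" where
  "dominating_kernel \<LL> H \<longleftrightarrow>
     H \<in> borel_measurable lebesgue \<and> (\<forall>y. 0 \<le> H y) \<and>
     integrable lebesgue (\<lambda>y. trunc_sq y * H y) \<and> (\<forall>K\<in>\<LL>. kernel K \<and> (AE y in lebesgue. K y \<le> H y))"

lemma operator_class_dominated:
  fixes \<LL> :: "(real ^ 'n \<Rightarrow> real) set"
  assumes "operator_class \<LL>"
  obtains H where "dominating_kernel \<LL> H"
proof -
  define S where "S y = (SUP K\<in>\<LL>. ennreal (K y))" for y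
  define H where "H y = enn2real (S y)" for y
  have [measurable]: "S \<in> borel_measurable lebesgue"
    and fin: "(\<integral>\<^sup>+y. ennreal (trunc_sq y) * S y \<partial>lebesgue) < \<infinity>"
    and ker: "\<And>K. K \<in> \<LL> \<Longrightarrow> kernel K"
    using assms by (auto simp: operator_class_def S_def[abs_def] trunc_sq_def)
  have [measurable]: "H \<in> borel_measurable lebesgue"
    unfolding H_def by measurable
  \<comment> \<open>Finiteness of the weighted integral says nothing at the origin, where the weight vanishes.\<close>
  have "AE y in lebesgue. ennreal (trunc_sq y) * S y \<noteq> \<infinity>"
    using fin by (intro nn_integral_PInf_AE) auto
  moreover have "AE y in lebesgue. y \<noteq> (0 :: real ^ 'n)"
    by (rule AE_I'[of "{0}"]) (auto simp: negligible_iff_null_sets[symmetric])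
  ultimately have AE_fin: "AE y in lebesgue. S y < \<infinity>"
  proof eventually_elim
    case (elim y)
    then have "ennreal (trunc_sq y) \<noteq> 0" by (auto simp: trunc_sq_def ennreal_eq_0_iff min_def)
    with elim(1) show ?case by (auto simp: ennreal_mult_eq_top_iff less_top)
  qed
  have "(\<integral>\<^sup>+y. ennreal (norm (trunc_sq y * H y)) \<partial>lebesgue) = (\<integral>\<^sup>+y. ennreal (trunc_sq y) * S y \<partial>lebesgue)"
    using AE_fin
    by (intro nn_integral_cong_AE, eventually_elim)
       (auto simp: H_def ennreal_mult trunc_sq_nonneg)
  then have "integrable lebesgue (\<lambda>y. trunc_sq y * H y)"
    using fin by (intro integrableI_bounded) auto
  moreover have "AE y in lebesgue. K y \<le> H y" if "K \<in> \<LL>" for K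
    using AE_fin
  proof eventually_elim
    case (elim y)
    have "ennreal (K y) \<le> S y" unfolding S_def by (rule SUP_upper[OF that])
    also have "\<dots> = ennreal (H y)" using elim by (simp add: H_def)
    finally show ?case by (simp add: H_def ennreal_le_iff)
  qed
  ultimately have "dominating_kernel \<LL> H"
    unfolding dominating_kernel_def using ker by (auto simp: H_def)
  then show thesis by (rule that)
qed

lemma mu_measurable [measurable]:
  fixes u :: "real ^ 'n \<Rightarrow> real"
  assumes [measurable]: "u \<in> borel_measurable lebesgue"
  shows "mu R u x \<in> borel_measurable lebesgue"
proof -
  have [measurable]: "(\<lambda>y. u (x + y)) \<in> borel_measurable lebesgue"
    by (rule measurable_compose[OF lebesgue_measurable_translation]) simp
  have [measurable]: "(\<lambda>y. (grad u x \<bullet> y) * indicator (ball 0 R) y) \<in> borel_measurable lebesgue"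
    by (intro borel_measurable_lebesgueI borel_measurable_times borel_measurable_indicator) auto
  show ?thesis unfolding mu_def by measurable
qed

text \<open>
  The constant is explicit in the data of \<open>u\<close> at \<open>x\<close>, so that it can be chosen locally uniformly in
  \<open>x\<close>.
\<close>

lemma mu_bound:
  fixes u :: "real ^ 'n \<Rightarrow> real"
  assumes u: "\<And>z. \<bar>u z\<bar> \<le> B" and p: "norm (grad u x) \<le> P"
    and r: "0 < r" "r \<le> 1" and "0 \<le> M"
    and expansion: "\<And>y. norm y < r \<Longrightarrow> \<bar>u (x + y) - u x - grad u x \<bullet> y\<bar> \<le> M * (norm y)\<^sup>2"
  shows "\<bar>mu 1 u x y\<bar> \<le> (M + (2 * B + P) / r\<^sup>2) * trunc_sq y"
proof -
  have nn: "0 \<le> B" "0 \<le> P" using u[of 0] p norm_ge_zero[of "grad u x"] by linarith+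
  show ?thesis
  proof (cases "norm y < r")
    case True
    then have "(norm y)\<^sup>2 \<le> 1" using r by (auto intro!: power_le_one)
    then have "trunc_sq y = (norm y)\<^sup>2" by (simp add: trunc_sq_def)
    moreover have "mu 1 u x y = u (x + y) - u x - grad u x \<bullet> y"
      using True r by (simp add: mu_def)
    ultimately have "\<bar>mu 1 u x y\<bar> \<le> M * trunc_sq y" using expansion[OF True] by simp
    also have "\<dots> \<le> (M + (2 * B + P) / r\<^sup>2) * trunc_sq y"
      using nn by (intro mult_right_mono) (auto simp: trunc_sq_nonneg)
    finally show ?thesis .
  next
    case False
    have "\<bar>(grad u x \<bullet> y) * indicator (ball 0 1) y\<bar> \<le> P"
    proof (cases "y \<in> ball 0 1")
      case True
      have "\<bar>grad u x \<bullet> y\<bar> \<le> norm (grad u x) * norm y" by (rule Cauchy_Schwarz_ineq2)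
      also have "\<dots> \<le> P * 1" using True p nn by (intro mult_mono) auto
      finally show ?thesis using True by simp
    qed (use nn in simp)
    then have "\<bar>mu 1 u x y\<bar> \<le> 2 * B + P"
      using u[of "x + y"] u[of x] unfolding mu_def by linarith
    also have "\<dots> = (2 * B + P) / r\<^sup>2 * r\<^sup>2" using r by simp
    also have "\<dots> \<le> (2 * B + P) / r\<^sup>2 * trunc_sq y"
      using False r nn by (intro mult_left_mono trunc_sq_lower) auto
    also have "\<dots> \<le> (M + (2 * B + P) / r\<^sup>2) * trunc_sq y"
      using \<open>0 \<le> M\<close> by (intro mult_right_mono) (auto simp: trunc_sq_nonneg)
    finally show ?thesis .
  qed
qed

lemma bounded_functionsD:
  assumes "u \<in> bounded_functions"
  shows "u \<in> borel_measurable lebesgue" and "\<exists>B\<ge>0. \<forall>z. \<bar>u z\<bar> \<le> B"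
proof -
  show "u \<in> borel_measurable lebesgue" using assms by (simp add: bounded_functions_def)
  have "bounded (range u)" using assms by (simp add: bounded_functions_def)
  then obtain B where B: "\<And>z. \<bar>u z\<bar> \<le> B" by (auto simp: bounded_iff)
  then have "0 \<le> B" using abs_ge_zero order_trans by blast
  with B show "\<exists>B\<ge>0. \<forall>z. \<bar>u z\<bar> \<le> B" by blast
qed

lemma bounded_functionsI:
  assumes "u \<in> borel_measurable lebesgue" "\<And>z. \<bar>u z\<bar> \<le> B"
  shows "u \<in> bounded_functions"
  using assms by (auto simp: bounded_functions_def bounded_iff)

lemma bounded_functions_diff:
  assumes "u \<in> bounded_functions" "v \<in> bounded_functions"
  shows "(\<lambda>z. u z - v z) \<in> bounded_functions"
  using assms bounded_minus_comp[of u UNIV v] by (auto simp: bounded_functions_def)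

lemma C11_mu_bound:
  fixes u :: "real ^ 'n \<Rightarrow> real"
  assumes "u \<in> C11_at x" "u \<in> bounded_functions"
  obtains C where "0 \<le> C" "\<And>y. \<bar>mu 1 u x y\<bar> \<le> C * trunc_sq y"
proof -
  obtain M r where M: "0 < M" "0 < r" "r \<le> 1"
    "\<And>y. norm y < r \<Longrightarrow> \<bar>u (x + y) - u x - grad u x \<bullet> y\<bar> \<le> M * (norm y)\<^sup>2"
    using C11_atD[OF assms(1)] by blast
  obtain B where B: "0 \<le> B" "\<And>z. \<bar>u z\<bar> \<le> B"
    using bounded_functionsD(2)[OF assms(2)] by blast
  show thesis
  proof (rule that)
    show "0 \<le> M + (2 * B + norm (grad u x)) / r\<^sup>2" using M B by simp
    show "\<bar>mu 1 u x y\<bar> \<le> (M + (2 * B + norm (grad u x)) / r\<^sup>2) * trunc_sq y" for y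
      by (rule mu_bound) (use M B in auto)
  qed
qed

lemma has_pv_integral_unique:
  assumes "has_pv_integral f l" "has_pv_integral f l'"
  shows "l = l'"
  using assms unfolding has_pv_integral_def
  by (auto intro: tendsto_unique[OF trivial_limit_at_right_real])

text \<open>
  The integrands of the operators of a class are absolutely integrable where a bounded \<open>u\<close> is \<open>C\<^sup>1\<^sup>,\<^sup>1\<close>; there
  all principal values become Lebesgue integrals.
\<close>

lemma integrable_has_pv_integral:
  fixes f :: "real ^ 'n \<Rightarrow> real"
  assumes f: "integrable lebesgue f"
  shows "has_pv_integral f (integral\<^sup>L lebesgue f)"
  unfolding has_pv_integral_def
proof (intro conjI allI impI)
  have [measurable]: "f \<in> borel_measurable lebesgue" using f by auto
  have [measurable]: "- ball (0 :: real ^ 'n) \<epsilon> \<in> sets lebesgue" for \<epsilon> by auto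
  show int: "set_integrable lebesgue (- ball 0 \<epsilon>) f" for \<epsilon>
    unfolding set_integrable_def by (rule integrable_mult_indicator[OF _ f]) auto
  show "((\<lambda>\<epsilon>. LINT y:- ball 0 \<epsilon>|lebesgue. f y) \<longlongrightarrow> integral\<^sup>L lebesgue f) (at_right 0)"
  proof (rule tendsto_at_right_sequentially[of 0 1])
    fix S :: "nat \<Rightarrow> real"
    assume S: "\<And>n. 0 < S n" "S \<longlonglongrightarrow> 0"
    have meas: "(\<lambda>y. indicat_real (- ball 0 (S n)) y *\<^sub>R f y) \<in> borel_measurable lebesgue" for n
      using int[of "S n"] unfolding set_integrable_def by (rule borel_measurable_integrable)
    show "(\<lambda>n. LINT y:- ball 0 (S n)|lebesgue. f y) \<longlonglongrightarrow> integral\<^sup>L lebesgue f"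
      unfolding set_lebesgue_integral_def
    proof (rule integral_dominated_convergence[where w = "\<lambda>y. \<bar>f y\<bar>"])
      have "AE y in lebesgue. y \<noteq> (0 :: real ^ 'n)"
        by (rule AE_I'[of "{0}"]) (auto simp: negligible_iff_null_sets[symmetric])
      then show "AE y in lebesgue. (\<lambda>n. indicat_real (- ball 0 (S n)) y *\<^sub>R f y) \<longlonglongrightarrow> f y"
      proof eventually_elim
        case (elim y)
        then have "\<forall>\<^sub>F n in sequentially. S n < norm y"
          using S(2) by (intro order_tendstoD) auto
        then have "\<forall>\<^sub>F n in sequentially. f y = indicat_real (- ball 0 (S n)) y *\<^sub>R f y"
          by eventually_elim (auto simp: indicator_def)
        then show ?case by (rule Lim_transform_eventually[OF tendsto_const])
      qed
    qed (use f meas in \<open>auto simp: indicator_def\<close>)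
  qed simp
qed

lemma lin_op_integrable:
  fixes u :: "real ^ 'n \<Rightarrow> real"
  assumes "u differentiable (at x)" "integrable lebesgue (\<lambda>y. mu R u x y * K y)"
  shows "lin_op_R R K u x = Some (\<integral>y. mu R u x y * K y \<partial>lebesgue)"
  using integrable_has_pv_integral[OF assms(2)] assms(1) has_pv_integral_unique
  unfolding lin_op_R_def by (auto intro!: the_equality)

lemma dominated_abs_integrable:
  fixes f :: "real ^ 'n \<Rightarrow> real"
  assumes H: "dominating_kernel \<LL> H"
    and [measurable]: "f \<in> borel_measurable lebesgue" and f: "\<And>y. \<bar>f y\<bar> \<le> C * trunc_sq y"
  shows "integrable lebesgue (\<lambda>y. \<bar>f y\<bar> * H y)"
    and "(\<integral>y. \<bar>f y\<bar> * H y \<partial>lebesgue) \<le> C * (\<integral>y. trunc_sq y * H y \<partial>lebesgue)"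
proof -
  have [measurable]: "H \<in> borel_measurable lebesgue"
    and H0: "\<And>y. 0 \<le> H y" and int: "integrable lebesgue (\<lambda>y. trunc_sq y * H y)"
    using H by (auto simp: dominating_kernel_def)
  have int': "integrable lebesgue (\<lambda>y. C * (trunc_sq y * H y))" using int by simp
  have fH: "\<bar>f y\<bar> * H y \<le> C * (trunc_sq y * H y)" for y
    using mult_right_mono[OF f[of y] H0[of y]] by (simp add: mult.assoc)
  show 1: "integrable lebesgue (\<lambda>y. \<bar>f y\<bar> * H y)"
    by (rule Bochner_Integration.integrable_bound[OF int'])
       (auto intro!: AE_I2 simp: H0 abs_of_nonneg order_trans[OF fH abs_ge_self])
  have "(\<integral>y. \<bar>f y\<bar> * H y \<partial>lebesgue) \<le> (\<integral>y. C * (trunc_sq y * H y) \<partial>lebesgue)"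
    using 1 int' fH by (intro integral_mono) auto
  then show "(\<integral>y. \<bar>f y\<bar> * H y \<partial>lebesgue) \<le> C * (\<integral>y. trunc_sq y * H y \<partial>lebesgue)"
    by simp
qed

lemma dominated_integrable:
  fixes f K :: "real ^ 'n \<Rightarrow> real"
  assumes H: "dominating_kernel \<LL> H" and K: "K \<in> \<LL>"
    and [measurable]: "f \<in> borel_measurable lebesgue" and f: "\<And>y. \<bar>f y\<bar> \<le> C * trunc_sq y"
  shows "integrable lebesgue (\<lambda>y. f y * K y)"
    and "\<bar>\<integral>y. f y * K y \<partial>lebesgue\<bar> \<le> (\<integral>y. \<bar>f y\<bar> * H y \<partial>lebesgue)"
proof -
  have [measurable]: "H \<in> borel_measurable lebesgue" "K \<in> borel_measurable lebesgue"
    and H0: "\<And>y. 0 \<le> H y" and K0: "\<And>y. 0 \<le> K y" and KH: "AE y in lebesgue. K y \<le> H y"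
    using H K by (auto simp: dominating_kernel_def kernel_def)
  note 1 = dominated_abs_integrable(1)[OF H _ f]
  have fK: "AE y in lebesgue. \<bar>f y * K y\<bar> \<le> \<bar>f y\<bar> * H y"
    using KH by eventually_elim (auto simp: abs_mult K0 intro!: mult_left_mono)
  show 2: "integrable lebesgue (\<lambda>y. f y * K y)"
    by (rule Bochner_Integration.integrable_bound[OF 1])
       (use fK in \<open>auto simp: abs_mult H0 elim!: eventually_mono\<close>)
  have "\<bar>\<integral>y. f y * K y \<partial>lebesgue\<bar> \<le> (\<integral>y. \<bar>f y * K y\<bar> \<partial>lebesgue)"
    by (rule integral_abs_bound)
  also have "\<dots> \<le> (\<integral>y. \<bar>f y\<bar> * H y \<partial>lebesgue)"
    using 1 2 fK by (intro integral_mono_AE) auto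
  finally show "\<bar>\<integral>y. f y * K y \<partial>lebesgue\<bar> \<le> (\<integral>y. \<bar>f y\<bar> * H y \<partial>lebesgue)" .
qed

lemma dominated_lin_op:
  fixes u K :: "real ^ 'n \<Rightarrow> real"
  assumes H: "dominating_kernel \<LL> H" and K: "K \<in> \<LL>"
    and u: "u \<in> C11_at x" "u \<in> bounded_functions"
  shows "integrable lebesgue (\<lambda>y. mu 1 u x y * K y)"
    and "lin_op K u x = Some (\<integral>y. mu 1 u x y * K y \<partial>lebesgue)"
proof -
  obtain C where "\<And>y. \<bar>mu 1 u x y\<bar> \<le> C * trunc_sq y" using C11_mu_bound[OF u] by blast
  then show int: "integrable lebesgue (\<lambda>y. mu 1 u x y * K y)"
    using bounded_functionsD(1)[OF u(2)] by (intro dominated_integrable(1)[OF H K]) auto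
  show "lin_op K u x = Some (\<integral>y. mu 1 u x y * K y \<partial>lebesgue)"
    by (rule lin_op_integrable[OF C11_at_differentiable[OF u(1)] int])
qed

lemma mu_diff:
  fixes u v :: "real ^ 'n \<Rightarrow> real"
  assumes "u \<in> C11_at x" "v \<in> C11_at x"
  shows "mu R (\<lambda>z. u z - v z) x y = mu R u x y - mu R v x y"
  by (simp add: mu_def C11_at_diff(2)[OF assms] algebra_simps)

lemma dominated_lin_op_diff:
  fixes u v K :: "real ^ 'n \<Rightarrow> real"
  assumes H: "dominating_kernel \<LL> H" and K: "K \<in> \<LL>"
    and u: "u \<in> C11_at x" "u \<in> bounded_functions" and v: "v \<in> C11_at x" "v \<in> bounded_functions"
  shows "the (lin_op K (\<lambda>z. u z - v z) x) = the (lin_op K u x) - the (lin_op K v x)"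
  using dominated_lin_op[OF H K u] dominated_lin_op[OF H K v]
    dominated_lin_op[OF H K C11_at_diff(1)[OF u(1) v(1)] bounded_functions_diff[OF u(2) v(2)]]
  by (simp add: mu_diff[OF u(1) v(1)] left_diff_distrib)

lemma dominated_lin_op_bdd:
  fixes u :: "real ^ 'n \<Rightarrow> real"
  assumes H: "dominating_kernel \<LL> H" and u: "u \<in> C11_at x" "u \<in> bounded_functions"
  shows "\<exists>A. \<forall>K\<in>\<LL>. \<bar>the (lin_op K u x)\<bar> \<le> A"
proof -
  obtain C where C: "\<And>y. \<bar>mu 1 u x y\<bar> \<le> C * trunc_sq y" using C11_mu_bound[OF u] by blast
  have "mu 1 u x \<in> borel_measurable lebesgue" using bounded_functionsD(1)[OF u(2)] by simp
  then have "\<bar>the (lin_op K u x)\<bar> \<le> C * (\<integral>y. trunc_sq y * H y \<partial>lebesgue)" if "K \<in> \<LL>" for K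
    using dominated_integrable(2)[OF H that _ C] dominated_abs_integrable(2)[OF H _ C]
      dominated_lin_op(2)[OF H that u] by fastforce
  then show ?thesis by blast
qed

text \<open>
  The extremal operators are defined through partial suprema and infima; the uniform bound
  \<open>dominated_lin_op_bdd\<close> ensures that they are genuine ones.
\<close>

lemma dominated_lin_op_M:
  fixes u K :: "real ^ 'n \<Rightarrow> real"
  assumes H: "dominating_kernel \<LL> H" and K: "K \<in> \<LL>"
    and u: "u \<in> C11_at x" "u \<in> bounded_functions"
  shows "the (M_minus \<LL> 1 u x) \<le> the (lin_op K u x)"
    and "the (lin_op K u x) \<le> the (M_plus \<LL> 1 u x)"
proof -
  have def: "\<forall>K\<in>\<LL>. lin_op K u x \<noteq> None" using dominated_lin_op(2)[OF H _ u] by auto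
  obtain A where A: "\<And>K. K \<in> \<LL> \<Longrightarrow> \<bar>the (lin_op K u x)\<bar> \<le> A"
    using dominated_lin_op_bdd[OF H u] by blast
  have bdd: "bdd_above ((\<lambda>K. the (lin_op K u x)) ` \<LL>)" "bdd_below ((\<lambda>K. the (lin_op K u x)) ` \<LL>)"
    using A unfolding abs_le_iff
    by (auto intro!: bdd_aboveI2[of _ _ A] bdd_belowI2[of _ "- A"] simp: minus_le_iff)
  show "the (M_minus \<LL> 1 u x) \<le> the (lin_op K u x)"
    using def bdd cINF_lower[OF bdd(2) K] by (simp add: M_minus_def inf_op_def)
  show "the (lin_op K u x) \<le> the (M_plus \<LL> 1 u x)"
    using def bdd cSUP_upper[OF K bdd(1)] by (simp add: M_plus_def sup_op_def)
qed

section \<open>Continuity of translations in weighted \<open>L\<^sup>1\<close>\<close>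

text \<open>
  Measurability provides continuous approximations; truncating them at height \<open>B\<close> makes them
  eligible for dominated convergence.
\<close>

lemma bounded_measurable_AE_limit_continuous:
  fixes u :: "'a::euclidean_space \<Rightarrow> real"
  assumes "u \<in> borel_measurable lebesgue" "\<And>z. \<bar>u z\<bar> \<le> B"
  obtains g where "\<And>n. continuous_on UNIV (g n)" "\<And>n z. \<bar>g n z\<bar> \<le> B"
    "AE z in lebesgue. (\<lambda>n. g n z) \<longlonglongrightarrow> u z"
proof -
  have "0 \<le> B" using abs_ge_zero order_trans assms(2) by blast
  have "u measurable_on UNIV"
    by (rule lebesgue_measurable_imp_measurable_on) (use assms in auto)
  then obtain N h where N: "negligible N" and h: "\<And>n. continuous_on UNIV (h n)"
      "\<And>z. z \<notin> N \<Longrightarrow> (\<lambda>n. h n z) \<longlonglongrightarrow> u z"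
    unfolding measurable_on_def by auto
  show thesis
  proof (rule that)
    show "continuous_on UNIV (\<lambda>z. max (- B) (min B (h n z)))" for n
      by (intro continuous_intros h)
    show "\<bar>max (- B) (min B (h n z))\<bar> \<le> B" for n z using \<open>0 \<le> B\<close> by auto
    have "(\<lambda>n. max (- B) (min B (h n z))) \<longlonglongrightarrow> u z" if "z \<notin> N" for z
    proof -
      have "max (- B) (min B (u z)) = u z" using assms(2)[of z] by auto
      moreover have "(\<lambda>n. max (- B) (min B (h n z))) \<longlonglongrightarrow> max (- B) (min B (u z))"
        by (intro tendsto_intros h that)
      ultimately show ?thesis by simp
    qed
    then show "AE z in lebesgue. (\<lambda>n. max (- B) (min B (h n z))) \<longlonglongrightarrow> u z"
      using N by (intro AE_I'[of N]) (auto simp: negligible_iff_null_sets)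
  qed
qed

lemma measurable_lebesgue_translate:
  "f \<in> borel_measurable lebesgue \<Longrightarrow> (\<lambda>y. f (x + y)) \<in> borel_measurable (lebesgue :: 'a::euclidean_space measure)"
  by (rule measurable_compose[OF lebesgue_measurable_translation])

lemma integrable_bounded_times:
  fixes f G :: "'a::euclidean_space \<Rightarrow> real"
  assumes "integrable lebesgue G" "f \<in> borel_measurable lebesgue" "\<And>y. \<bar>f y\<bar> \<le> C"
  shows "integrable lebesgue (\<lambda>y. f y * G y)"
proof (rule Bochner_Integration.integrable_bound)
  show "integrable lebesgue (\<lambda>y. C * G y)" using assms(1) by simp
  have "\<bar>f y * G y\<bar> \<le> \<bar>C * G y\<bar>" for y
    using assms(3)[of y] unfolding abs_mult by (intro mult_right_mono) auto
  then show "AE y in lebesgue. norm (f y * G y) \<le> norm (C * G y)" by simp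
qed (use assms in measurable)

text \<open>
  Approximate \<open>u\<close> by bounded continuous functions \<open>g n\<close>, for which the claim is dominated
  convergence. The error \<open>|u - g n|\<close> is evaluated at the moving points \<open>X k + y\<close>, so it has to be
  small uniformly in \<open>k\<close>: the weight is first cut down to a bounded, compactly supported weight
  \<open>T N\<close>, against which the translated error is at most its plain integral over one large ball.
\<close>

lemma translation_weighted_L1:
  fixes u G :: "'a::euclidean_space \<Rightarrow> real" and X :: "nat \<Rightarrow> 'a"
  assumes u[measurable]: "u \<in> borel_measurable lebesgue" and B: "\<And>z. \<bar>u z\<bar> \<le> B"
    and G: "integrable lebesgue G" and G0: "\<And>y. 0 \<le> G y"
    and X: "X \<longlonglongrightarrow> x"
  shows "(\<lambda>k. \<integral>y. \<bar>u (X k + y) - u (x + y)\<bar> * G y \<partial>lebesgue) \<longlonglongrightarrow> 0"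
proof -
  have [measurable]: "G \<in> borel_measurable lebesgue" using G by auto
  have B0: "0 \<le> B" using abs_ge_zero order_trans B by blast
  obtain g where g: "\<And>n. continuous_on UNIV (g n)" and gB: "\<And>n z. \<bar>g n z\<bar> \<le> B"
      and g_lim: "AE z in lebesgue. (\<lambda>n. g n z) \<longlonglongrightarrow> u z"
    using bounded_measurable_AE_limit_continuous[OF u B] by blast
  have g_meas[measurable]: "g n \<in> borel_measurable lebesgue" for n
    by (intro borel_measurable_lebesgueI borel_measurable_continuous_onI g)
  obtain \<rho> where \<rho>: "\<And>k. norm (X k) \<le> \<rho>"
    using convergent_imp_Bseq[of X] X by (auto simp: convergent_def Bseq_def)
  have x\<rho>: "norm x \<le> \<rho>"
    by (rule LIMSEQ_le_const2[OF tendsto_norm[OF X]]) (use \<rho> in auto)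
  have [measurable]: "(\<lambda>y. u (z + y)) \<in> borel_measurable lebesgue"
      "(\<lambda>y. g n (z + y)) \<in> borel_measurable lebesgue" for z n
    by (auto intro: measurable_lebesgue_translate[of u] measurable_lebesgue_translate[of "g n"])
  define e where "e n z = \<bar>u z - g n z\<bar>" for n z
  have [measurable]: "e n \<in> borel_measurable lebesgue" "(\<lambda>y. e n (z + y)) \<in> borel_measurable lebesgue" for n z
    unfolding e_def by measurable
  have e0: "0 \<le> e n z" and e2: "e n z \<le> 2 * B" for n z
    using B[of z] gB[of n z] by (auto simp: e_def)
  have ball_meas[measurable]: "ball (0::'a) r \<in> sets lebesgue" for r by auto
  define T where "T N y = min (G y) (real N) * indicator (ball 0 (real N)) y" for N y
  have [measurable]: "T N \<in> borel_measurable lebesgue" for N unfolding T_def by measurable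
  have T0: "0 \<le> T N y" and TG: "T N y \<le> G y" and TN: "T N y \<le> real N * indicator (ball 0 (real N)) y" for N y
    using G0[of y] by (auto simp: T_def indicator_def)
  define E where "E N n = (\<integral>z. e n z * indicator (ball 0 (real N + \<rho>)) z \<partial>lebesgue)" for N n
  have ball_int: "integrable lebesgue (indicat_real (ball (0::'a) r))" for r
    using emeasure_bounded_finite[OF bounded_ball, of "0::'a" r]
    by (simp add: integrable_indicator_iff top.not_eq_extremum)
  have T_int: "integrable lebesgue (T N)" for N
    by (rule Bochner_Integration.integrable_bound[OF G]) (auto simp: T0 TG G0)
  have rest: "(\<lambda>N. \<integral>y. G y - T N y \<partial>lebesgue) \<longlonglongrightarrow> 0"
  proof -
    have "(\<lambda>N. \<integral>y. G y - T N y \<partial>lebesgue) \<longlonglongrightarrow> integral\<^sup>L lebesgue (\<lambda>y::'a. 0 :: real)"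
    proof (rule integral_dominated_convergence[where w = G])
      show "AE y in lebesgue. (\<lambda>N. G y - T N y) \<longlonglongrightarrow> 0"
      proof (rule AE_I2)
        fix y
        obtain N0 :: nat where N0: "max (G y) (norm y + 1) \<le> real N0" using real_arch_simple by blast
        have "\<forall>\<^sub>F N in sequentially. 0 = G y - T N y"
          using eventually_ge_at_top[of N0]
        proof eventually_elim
          case (elim N)
          then have "real N0 \<le> real N" by simp
          then have "G y \<le> real N" "norm y < real N" using N0 by auto
          then show ?case by (simp add: T_def)
        qed
        then show "(\<lambda>N. G y - T N y) \<longlonglongrightarrow> 0" by (rule Lim_transform_eventually[OF tendsto_const])
      qed
      show "AE y in lebesgue. norm (G y - T N y) \<le> G y" for N
        using T0 TG by (auto simp: abs_le_iff)
    qed (use G in auto)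
    then show ?thesis by simp
  qed
  have E_lim: "E N \<longlonglongrightarrow> 0" for N
  proof -
    have "E N \<longlonglongrightarrow> integral\<^sup>L lebesgue (\<lambda>z::'a. 0 :: real)"
      unfolding E_def
    proof (rule integral_dominated_convergence)
      show "integrable lebesgue (\<lambda>z. 2 * B * indicat_real (ball (0::'a) (real N + \<rho>)) z)"
        using ball_int by simp
      show "AE z in lebesgue. (\<lambda>n. e n z * indicator (ball 0 (real N + \<rho>)) z) \<longlonglongrightarrow> 0"
        using g_lim
      proof eventually_elim
        case (elim z)
        then have "(\<lambda>n. e n z * indicator (ball 0 (real N + \<rho>)) z) \<longlonglongrightarrow> \<bar>u z - u z\<bar> * indicator (ball 0 (real N + \<rho>)) z"
          unfolding e_def by (intro tendsto_intros)
        then show ?case by simp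
      qed
      show "AE z in lebesgue. norm (e n z * indicator (ball 0 (real N + \<rho>)) z)
          \<le> 2 * B * indicator (ball 0 (real N + \<rho>)) z" for n
        using e0 e2 by (auto simp: indicator_def)
    qed measurable
    then show ?thesis by simp
  qed
  have e_shift: "(\<integral>y. e n (z + y) * T N y \<partial>lebesgue) \<le> real N * E N n" if z: "norm z \<le> \<rho>" for z N n
  proof -
    let ?f = "\<lambda>w. real N * (e n w * indicator (ball 0 (real N + \<rho>)) w)"
    have [measurable]: "?f \<in> borel_measurable lebesgue" by measurable
    have f_int: "integrable lebesgue ?f"
      using integrable_bounded_times[OF ball_int, of "e n" "2 * B"] e0 e2 by (simp add: abs_of_nonneg)
    have "(\<integral>y. e n (z + y) * T N y \<partial>lebesgue) \<le> (\<integral>y. ?f (z + y) \<partial>lebesgue)"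
    proof (rule integral_mono)
      show "integrable lebesgue (\<lambda>y. e n (z + y) * T N y)"
        by (rule integrable_bounded_times[OF T_int, where C = "2 * B"]) (use e0 e2 in \<open>auto simp: abs_of_nonneg\<close>)
      show "integrable lebesgue (\<lambda>y. ?f (z + y))"
        using f_int integrable_distr_eq[of "\<lambda>y. z + y" lebesgue lebesgue ?f]
        by (simp add: distr_lebesgue_translation)
      fix y
      have "e n (z + y) * T N y \<le> e n (z + y) * (real N * indicator (ball 0 (real N)) y)"
        by (intro mult_left_mono TN e0)
      also have "\<dots> \<le> e n (z + y) * (real N * indicator (ball 0 (real N + \<rho>)) (z + y))"
      proof (intro mult_left_mono e0)
        show "indicat_real (ball 0 (real N)) y \<le> indicator (ball 0 (real N + \<rho>)) (z + y)"
          using z norm_triangle_ineq[of z y] by (auto simp: indicator_def)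
      qed auto
      finally show "e n (z + y) * T N y \<le> ?f (z + y)" by (simp add: mult_ac)
    qed
    also have "\<dots> = (\<integral>w. ?f w \<partial>distr lebesgue lebesgue (\<lambda>y. z + y))"
      by (rule integral_distr[symmetric]) auto
    also have "\<dots> = real N * E N n"
      by (simp add: distr_lebesgue_translation E_def)
    finally show ?thesis .
  qed
  define D where "D n k = (\<integral>y. \<bar>g n (X k + y) - g n (x + y)\<bar> * G y \<partial>lebesgue)" for n k
  have gd: "\<bar>g n z - g n z'\<bar> \<le> 2 * B" for n z z' using gB[of n z] gB[of n z'] by linarith
  have D_lim: "D n \<longlonglongrightarrow> 0" for n
  proof -
    have "D n \<longlonglongrightarrow> integral\<^sup>L lebesgue (\<lambda>y::'a. 0 :: real)"
      unfolding D_def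
    proof (rule integral_dominated_convergence)
      show "integrable lebesgue (\<lambda>y. 2 * B * G y)" using G by simp
      show "AE y in lebesgue. (\<lambda>k. \<bar>g n (X k + y) - g n (x + y)\<bar> * G y) \<longlonglongrightarrow> 0"
      proof (rule AE_I2)
        fix y
        have "isCont (g n) (x + y)" using g continuous_on_eq_continuous_at[OF open_UNIV] by auto
        then have "(\<lambda>k. g n (X k + y)) \<longlonglongrightarrow> g n (x + y)"
          by (rule isCont_tendsto_compose) (intro tendsto_intros X)
        then have "(\<lambda>k. \<bar>g n (X k + y) - g n (x + y)\<bar> * G y) \<longlonglongrightarrow> \<bar>g n (x + y) - g n (x + y)\<bar> * G y"
          by (intro tendsto_intros)
        then show "(\<lambda>k. \<bar>g n (X k + y) - g n (x + y)\<bar> * G y) \<longlonglongrightarrow> 0" by simp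
      qed
      show "AE y in lebesgue. norm (\<bar>g n (X k + y) - g n (x + y)\<bar> * G y) \<le> 2 * B * G y" for k
        using gd G0 by (auto intro!: mult_right_mono simp: abs_mult)
    qed measurable
    then show ?thesis by simp
  qed
  have main: "(\<integral>y. \<bar>u (X k + y) - u (x + y)\<bar> * G y \<partial>lebesgue)
      \<le> 2 * B * (\<integral>y. G y - T N y \<partial>lebesgue) + 2 * (real N * E N n) + D n k" for k N n
  proof -
    have ud: "\<bar>u z - u z'\<bar> \<le> 2 * B" for z z' using B[of z] B[of z'] by linarith
    have i1: "integrable lebesgue (\<lambda>y. \<bar>u (X k + y) - u (x + y)\<bar> * G y)"
      by (rule integrable_bounded_times[OF G, where C = "2 * B"]) (use ud in auto)
    have i2: "integrable lebesgue (\<lambda>y. 2 * B * (G y - T N y))"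
      using G T_int by auto
    have i3: "integrable lebesgue (\<lambda>y. e n (z + y) * T N y)" for z
      by (rule integrable_bounded_times[OF T_int, where C = "2 * B"]) (use e0 e2 in \<open>auto simp: abs_of_nonneg\<close>)
    have i4: "integrable lebesgue (\<lambda>y. \<bar>g n (X k + y) - g n (x + y)\<bar> * G y)"
      by (rule integrable_bounded_times[OF G, where C = "2 * B"]) (use gd in auto)
    have "(\<integral>y. \<bar>u (X k + y) - u (x + y)\<bar> * G y \<partial>lebesgue) \<le>
        (\<integral>y. 2 * B * (G y - T N y) + (e n (X k + y) * T N y + e n (x + y) * T N y)
            + \<bar>g n (X k + y) - g n (x + y)\<bar> * G y \<partial>lebesgue)"
    proof (rule integral_mono[OF i1])
      show "integrable lebesgue (\<lambda>y. 2 * B * (G y - T N y) + (e n (X k + y) * T N y + e n (x + y) * T N y)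
            + \<bar>g n (X k + y) - g n (x + y)\<bar> * G y)"
        by (intro Bochner_Integration.integrable_add i2 i3 i4)
      fix y
      let ?a = "\<bar>u (X k + y) - u (x + y)\<bar>" and ?d = "\<bar>g n (X k + y) - g n (x + y)\<bar>"
      have "?a * G y = ?a * (G y - T N y) + ?a * T N y" by (simp add: algebra_simps)
      also have "\<dots> \<le> 2 * B * (G y - T N y) + (e n (X k + y) + e n (x + y) + ?d) * T N y"
        using ud TG T0 by (intro add_mono mult_right_mono) (auto simp: e_def)
      also have "\<dots> \<le> 2 * B * (G y - T N y) + (e n (X k + y) * T N y + e n (x + y) * T N y) + ?d * G y"
        using mult_left_mono[OF TG, of ?d N y] by (simp add: algebra_simps)
      finally show "?a * G y \<le> \<dots>" .
    qed
    also have "\<dots> = 2 * B * (\<integral>y. G y - T N y \<partial>lebesgue)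
        + ((\<integral>y. e n (X k + y) * T N y \<partial>lebesgue) + (\<integral>y. e n (x + y) * T N y \<partial>lebesgue)) + D n k"
      unfolding D_def
      by (simp only: Bochner_Integration.integral_add[OF Bochner_Integration.integrable_add[OF i2 Bochner_Integration.integrable_add[OF i3 i3]] i4]
          Bochner_Integration.integral_add[OF i2 Bochner_Integration.integrable_add[OF i3 i3]]
          Bochner_Integration.integral_add[OF i3 i3] integral_mult_right_zero)
    also have "\<dots> \<le> 2 * B * (\<integral>y. G y - T N y \<partial>lebesgue) + 2 * (real N * E N n) + D n k"
      using e_shift[OF \<rho>, of n k N] e_shift[OF x\<rho>, of n N] by simp
    finally show ?thesis .
  qed
  show ?thesis
  proof (rule LIMSEQ_I)
    fix \<epsilon> :: real assume "0 < \<epsilon>"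
    have "(\<lambda>N. 2 * B * (\<integral>y. G y - T N y \<partial>lebesgue)) \<longlonglongrightarrow> 0"
      using tendsto_mult_right_zero[OF rest] .
    then have "\<forall>\<^sub>F N in sequentially. 2 * B * (\<integral>y. G y - T N y \<partial>lebesgue) < \<epsilon> / 3"
      by (rule order_tendstoD) (use \<open>0 < \<epsilon>\<close> in simp)
    then obtain N where N: "2 * B * (\<integral>y. G y - T N y \<partial>lebesgue) < \<epsilon> / 3"
      by (auto simp: eventually_sequentially)
    have "(\<lambda>n. 2 * (real N * E N n)) \<longlonglongrightarrow> 0"
      using E_lim by (intro tendsto_mult_right_zero)
    then have "\<forall>\<^sub>F n in sequentially. 2 * (real N * E N n) < \<epsilon> / 3"
      by (rule order_tendstoD) (use \<open>0 < \<epsilon>\<close> in simp)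
    then obtain n where n: "2 * (real N * E N n) < \<epsilon> / 3"
      by (auto simp: eventually_sequentially)
    have "\<forall>\<^sub>F k in sequentially. D n k < \<epsilon> / 3"
      by (rule order_tendstoD[OF D_lim]) (use \<open>0 < \<epsilon>\<close> in simp)
    then obtain k0 where k0: "\<And>k. k \<ge> k0 \<Longrightarrow> D n k < \<epsilon> / 3"
      by (auto simp: eventually_sequentially)
    have "norm ((\<integral>y. \<bar>u (X k + y) - u (x + y)\<bar> * G y \<partial>lebesgue) - 0) < \<epsilon>" if "k \<ge> k0" for k
    proof -
      have "0 \<le> (\<integral>y. \<bar>u (X k + y) - u (x + y)\<bar> * G y \<partial>lebesgue)"
        using G0 by (intro integral_nonneg_AE) auto
      then show ?thesis using main[of k N n] N n k0[OF that] by simp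
    qed
    then show "\<exists>k0. \<forall>k\<ge>k0. norm ((\<integral>y. \<bar>u (X k + y) - u (x + y)\<bar> * G y \<partial>lebesgue) - 0) < \<epsilon>" by blast
  qed
qed

section \<open>Ellipticity of suprema and infima\<close>

text \<open>
  Split at a small radius \<open>1 / (j + 1)\<close>. Inside, both integrands are at most a fixed multiple of
  \<open>|y|\<^sup>2 H(y)\<close>, uniformly for points near \<open>x\<close>, whose integral over small balls is small (\<open>c j\<close>).
  Outside, \<open>H y\<close> is at most a multiple of the integrable weight \<open>trunc_sq y * H y\<close>, and the
  difference is controlled by the continuity of translations (\<open>a k\<close>) and by the continuity of \<open>u\<close>
  and its gradient at \<open>x\<close> (\<open>b k\<close>).
\<close>

lemma mu_weighted_L1_continuous:
  fixes u :: "real ^ 'n \<Rightarrow> real" and X :: "nat \<Rightarrow> real ^ 'n"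
  assumes H: "dominating_kernel \<LL> H" and "open \<Omega>"
    and u: "u \<in> C11_on \<Omega>" "u \<in> bounded_functions"
    and x: "x \<in> \<Omega>" and X: "X \<longlonglongrightarrow> x"
  shows "(\<lambda>k. \<integral>y. \<bar>mu 1 u (X k) y - mu 1 u x y\<bar> * H y \<partial>lebesgue) \<longlonglongrightarrow> 0"
proof -
  have [measurable]: "H \<in> borel_measurable lebesgue" and H0: "\<And>y. 0 \<le> H y"
    and G: "integrable lebesgue (\<lambda>y. trunc_sq y * H y)"
    using H by (auto simp: dominating_kernel_def)
  have [measurable]: "u \<in> borel_measurable lebesgue"
    using bounded_functionsD(1)[OF u(2)] .
  obtain B where B: "0 \<le> B" "\<And>z. \<bar>u z\<bar> \<le> B" using bounded_functionsD(2)[OF u(2)] by blast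
  obtain M where M: "0 < M" "\<And>z. z \<in> \<Omega> \<Longrightarrow> C11_bound M u z"
    using u(1) by (auto simp: C11_on_def)
  obtain R where R: "0 < R" "ball x R \<subseteq> \<Omega>" using \<open>open \<Omega>\<close> x open_contains_ball by blast
  have M': "\<And>z. z \<in> ball x R \<Longrightarrow> C11_bound M u z" using M(2) R(2) by blast
  \<comment> \<open>Every ball of radius \<open>r\<close> centred within \<open>r\<close> of \<open>x\<close> lies in \<open>ball x R\<close>.\<close>
  define r where "r = min (R / 2) 1"
  have r: "0 < r" "r \<le> 1" "2 * r \<le> R" using R(1) by (auto simp: r_def)
  define P where "P = norm (grad u x) + 6 * (M + 1) * r"
  define C where "C = (M + 1) + (2 * B + P) / r\<^sup>2"
  have bound: "\<bar>mu 1 u z y\<bar> \<le> C * trunc_sq y"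
    and lip: "norm (grad u z - grad u x) \<le> 6 * (M + 1) * norm (z - x)" if z: "norm (z - x) < r" for z y
  proof -
    have "norm (z - x) < R / 2" using z r by simp
    then show lip: "norm (grad u z - grad u x) \<le> 6 * (M + 1) * norm (z - x)"
      using C11_grad_Lipschitz[OF M'] M(1) by simp
    have "norm (grad u z) \<le> norm (grad u x) + norm (grad u z - grad u x)"
      using norm_triangle_sub by blast
    also have "\<dots> \<le> P" unfolding P_def
      using lip z M(1) by (intro add_mono order_trans[OF lip] mult_left_mono) auto
    finally have p: "norm (grad u z) \<le> P" .
    show "\<bar>mu 1 u z y\<bar> \<le> C * trunc_sq y"
      unfolding C_def
    proof (rule mu_bound[OF B(2) p r(1,2)])
      fix w :: "real ^ 'n" assume w: "norm w < r"
      have zR: "z \<in> ball x R" using z r by (simp add: dist_norm norm_minus_commute)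
      have "dist x (z + w) = norm ((z - x) + w)" by (simp add: dist_norm norm_minus_commute algebra_simps)
      also have "\<dots> < R" using norm_triangle_ineq[of "z - x" w] z w r by linarith
      finally have "z + w \<in> ball x R" by simp
      then show "\<bar>u (z + w) - u z - grad u z \<bullet> w\<bar> \<le> (M + 1) * (norm w)\<^sup>2"
        using C11_convex_expansion[OF convex_ball zR _ M'] by simp
    qed (use M in simp)
  qed
  have near: "\<forall>\<^sub>F k in sequentially. norm (X k - x) < r"
    using X r(1) by (simp add: tendsto_iff dist_norm)
  define a where "a k = (\<integral>y. \<bar>u (X k + y) - u (x + y)\<bar> * (trunc_sq y * H y) \<partial>lebesgue)" for k
  define b where "b k = \<bar>u (X k) - u x\<bar> + norm (grad u (X k) - grad u x)" for k
  have a_lim: "a \<longlonglongrightarrow> 0"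
    unfolding a_def
    by (rule translation_weighted_L1[OF _ B(2) G _ X]) (auto simp: H0 trunc_sq_nonneg)
  have b_lim: "b \<longlonglongrightarrow> 0"
  proof -
    have "isCont u x"
      using C11_at_differentiable[OF C11_on_at[OF u(1) x]] differentiable_imp_continuous_within by blast
    then have "(\<lambda>k. u (X k)) \<longlonglongrightarrow> u x" using X by (rule isCont_tendsto_compose)
    then have 1: "(\<lambda>k. \<bar>u (X k) - u x\<bar>) \<longlonglongrightarrow> 0"
      by (simp add: LIM_zero tendsto_rabs_zero)
    have 2: "(\<lambda>k. 6 * (M + 1) * norm (X k - x)) \<longlonglongrightarrow> 0"
      using X by (intro tendsto_mult_right_zero tendsto_norm_zero LIM_zero)
    have "(\<lambda>k. norm (grad u (X k) - grad u x)) \<longlonglongrightarrow> 0"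
      by (rule Lim_null_comparison[OF _ 2]) (use near lip in \<open>auto elim!: eventually_mono\<close>)
    from tendsto_add[OF 1 this] show ?thesis unfolding b_def by simp
  qed
  \<comment> \<open>The contribution of the small balls, on which translations of \<open>u\<close> cannot be compared in the weight \<open>H\<close>.\<close>
  define c where "c j = (\<integral>y. indicator (ball 0 (1 / real (Suc j))) y * (trunc_sq y * H y) \<partial>lebesgue)" for j
  have ball_meas[measurable]: "ball (0 :: real ^ 'n) s \<in> sets lebesgue" for s by auto
  have c_int: "integrable lebesgue (\<lambda>y. indicator (ball 0 s) y * (trunc_sq y * H y))" for s
    using integrable_mult_indicator[OF ball_meas G] by simp
  have c_lim: "c \<longlonglongrightarrow> 0"
  proof -
    have "c \<longlonglongrightarrow> integral\<^sup>L lebesgue (\<lambda>y :: real ^ 'n. 0 :: real)"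
      unfolding c_def
    proof (rule integral_dominated_convergence[where w = "\<lambda>y. trunc_sq y * H y"])
      show "AE y in lebesgue. (\<lambda>j. indicator (ball 0 (1 / real (Suc j))) y * (trunc_sq y * H y)) \<longlonglongrightarrow> 0"
      proof (rule AE_I2)
        fix y :: "real ^ 'n"
        show "(\<lambda>j. indicator (ball 0 (1 / real (Suc j))) y * (trunc_sq y * H y)) \<longlonglongrightarrow> 0"
        proof (cases "y = 0")
          case False
          then have "\<forall>\<^sub>F j in sequentially. 1 / real (Suc j) < norm y"
            using LIMSEQ_inverse_real_of_nat by (intro order_tendstoD) (auto simp: inverse_eq_divide)
          then have "\<forall>\<^sub>F j in sequentially. 0 = indicator (ball 0 (1 / real (Suc j))) y * (trunc_sq y * H y)"
            by eventually_elim (auto simp: indicator_def)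
          then show ?thesis by (rule Lim_transform_eventually[OF tendsto_const])
        qed (simp add: trunc_sq_def)
      qed
      show "(\<lambda>y. indicator (ball 0 (1 / real (Suc j))) y * (trunc_sq y * H y)) \<in> borel_measurable lebesgue" for j
        using c_int by (rule borel_measurable_integrable)
    qed (use G in \<open>auto simp: indicator_def H0 trunc_sq_nonneg\<close>)
    then show ?thesis by simp
  qed
  have C0: "0 \<le> C" using M(1) B(1) r(1) by (simp add: C_def P_def)
  let ?I = "\<integral>y. trunc_sq y * H y \<partial>lebesgue"
  have main: "(\<integral>y. \<bar>mu 1 u (X k) y - mu 1 u x y\<bar> * H y \<partial>lebesgue)
      \<le> 2 * C * c j + (real (Suc j))\<^sup>2 * (a k + b k * ?I)" if k: "norm (X k - x) < r" for j k
  proof -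
    define d where "d = 1 / real (Suc j)"
    have d: "0 < d" "d \<le> 1" by (auto simp: d_def)
    let ?D = "\<lambda>y. mu 1 u (X k) y - mu 1 u x y"
    let ?a = "\<lambda>y. \<bar>u (X k + y) - u (x + y)\<bar>"
    have D1: "\<bar>?D y\<bar> \<le> 2 * C * trunc_sq y" for y
      using bound[OF k, of y] bound[of x y] r(1) by simp
    have D2: "\<bar>?D y\<bar> \<le> ?a y + b k" for y
    proof -
      have "\<bar>(grad u (X k) - grad u x) \<bullet> y * indicator (ball 0 1) y\<bar> \<le> norm (grad u (X k) - grad u x)"
      proof (cases "y \<in> ball 0 1")
        case True
        then have "\<bar>(grad u (X k) - grad u x) \<bullet> y\<bar> \<le> norm (grad u (X k) - grad u x) * 1"
          by (intro order_trans[OF Cauchy_Schwarz_ineq2] mult_left_mono) auto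
        then show ?thesis using True by simp
      qed simp
      then show ?thesis unfolding mu_def b_def by (simp add: algebra_simps)
    qed
    have D_int: "integrable lebesgue (\<lambda>y. \<bar>?D y\<bar> * H y)"
      by (rule dominated_abs_integrable(1)[OF H _ D1]) measurable
    have tr: "(\<lambda>y. u (z + y)) \<in> borel_measurable lebesgue" for z
      by (rule measurable_lebesgue_translate) simp
    have a_bd: "\<bar>?a y\<bar> \<le> 2 * B" for y using B(2)[of "X k + y"] B(2)[of "x + y"] by simp
    have a_int: "integrable lebesgue (\<lambda>y. ?a y * (trunc_sq y * H y))"
      by (rule integrable_bounded_times[OF G _ a_bd]) (use tr in measurable)
    let ?f = "\<lambda>y. 2 * C * (indicator (ball 0 d) y * (trunc_sq y * H y))"
    let ?g = "\<lambda>y. (real (Suc j))\<^sup>2 * (?a y * (trunc_sq y * H y) + b k * (trunc_sq y * H y))"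
    have "(\<integral>y. \<bar>?D y\<bar> * H y \<partial>lebesgue) \<le> (\<integral>y. ?f y + ?g y \<partial>lebesgue)"
    proof (rule integral_mono[OF D_int])
      show "integrable lebesgue (\<lambda>y. ?f y + ?g y)" using c_int a_int G by simp
      fix y
      have nn: "0 \<le> ?f y" "0 \<le> ?g y" using C0 H0 by (auto simp: trunc_sq_nonneg b_def)
      show "\<bar>?D y\<bar> * H y \<le> ?f y + ?g y"
      proof (cases "y \<in> ball 0 d")
        case True
        then have "\<bar>?D y\<bar> * H y \<le> ?f y"
          using mult_right_mono[OF D1 H0, of y] by (simp add: mult_ac)
        then show ?thesis using nn by linarith
      next
        case False
        then have "d\<^sup>2 \<le> trunc_sq y" using d by (intro trunc_sq_lower) auto
        then have "1 \<le> (real (Suc j))\<^sup>2 * trunc_sq y"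
          by (simp add: d_def power_divide divide_le_eq mult.commute)
        then have "(?a y + b k) * H y * 1 \<le> (?a y + b k) * H y * ((real (Suc j))\<^sup>2 * trunc_sq y)"
          using H0 by (intro mult_left_mono) (auto simp: b_def)
        also have "\<dots> = ?g y" by (simp add: algebra_simps)
        finally have "(?a y + b k) * H y \<le> ?g y" by simp
        then have "\<bar>?D y\<bar> * H y \<le> ?g y" by (rule order_trans[OF mult_right_mono[OF D2 H0]])
        then show ?thesis using nn by linarith
      qed
    qed
    also have "\<dots> = 2 * C * c j + (real (Suc j))\<^sup>2 * (a k + b k * ?I)"
    proof -
      have i: "integrable lebesgue ?f" "integrable lebesgue ?g"
          "integrable lebesgue (\<lambda>y. b k * (trunc_sq y * H y))"
        using c_int a_int G by simp_all
      show ?thesis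
        unfolding Bochner_Integration.integral_add[OF i(1,2)] integral_mult_right_zero
          Bochner_Integration.integral_add[OF a_int i(3)]
        unfolding a_def c_def d_def ..
    qed
    finally show ?thesis .
  qed
  show ?thesis
  proof (rule LIMSEQ_I)
    fix \<epsilon> :: real assume "0 < \<epsilon>"
    have "\<forall>\<^sub>F j in sequentially. 2 * C * c j < \<epsilon> / 2"
      by (rule order_tendstoD[OF tendsto_mult_right_zero[OF c_lim]]) (use \<open>0 < \<epsilon>\<close> in simp)
    then obtain j where j: "2 * C * c j < \<epsilon> / 2"
      by (auto simp: eventually_sequentially)
    have "(\<lambda>k. (real (Suc j))\<^sup>2 * (a k + b k * ?I)) \<longlonglongrightarrow> (real (Suc j))\<^sup>2 * (0 + 0 * ?I)"
      by (intro tendsto_intros a_lim b_lim)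
    then have "\<forall>\<^sub>F k in sequentially. (real (Suc j))\<^sup>2 * (a k + b k * ?I) < \<epsilon> / 2"
      by (rule order_tendstoD) (use \<open>0 < \<epsilon>\<close> in simp)
    with near have "\<forall>\<^sub>F k in sequentially.
        norm ((\<integral>y. \<bar>mu 1 u (X k) y - mu 1 u x y\<bar> * H y \<partial>lebesgue) - 0) < \<epsilon>"
    proof eventually_elim
      case (elim k)
      have "0 \<le> (\<integral>y. \<bar>mu 1 u (X k) y - mu 1 u x y\<bar> * H y \<partial>lebesgue)"
        using H0 by (intro integral_nonneg_AE) auto
      then show ?case using main[OF elim(1), of j] j elim(2) by simp
    qed
    then show "\<exists>k0. \<forall>k\<ge>k0. norm ((\<integral>y. \<bar>mu 1 u (X k) y - mu 1 u x y\<bar> * H y \<partial>lebesgue) - 0) < \<epsilon>"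
      by (simp add: eventually_sequentially)
  qed
qed

text \<open>
  The right-hand side is the same for all kernels of the class, which is what makes suprema and
  infima over the class continuous.
\<close>

lemma lin_op_dist_le:
  fixes u K :: "real ^ 'n \<Rightarrow> real"
  assumes H: "dominating_kernel \<LL> H" and K: "K \<in> \<LL>" and ub: "u \<in> bounded_functions"
    and u: "u \<in> C11_at x" "u \<in> C11_at x'"
  shows "\<bar>the (lin_op K u x') - the (lin_op K u x)\<bar>
      \<le> (\<integral>y. \<bar>mu 1 u x' y - mu 1 u x y\<bar> * H y \<partial>lebesgue)"
proof -
  have [measurable]: "u \<in> borel_measurable lebesgue" by (rule bounded_functionsD(1)[OF ub])
  obtain C C' where "\<And>y. \<bar>mu 1 u x y\<bar> \<le> C * trunc_sq y" "\<And>y. \<bar>mu 1 u x' y\<bar> \<le> C' * trunc_sq y"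
    using C11_mu_bound[OF u(1) ub] C11_mu_bound[OF u(2) ub] by metis
  then have "\<bar>mu 1 u x' y - mu 1 u x y\<bar> \<le> (C + C') * trunc_sq y" for y
    by (smt (verit) distrib_right)
  from dominated_integrable(2)[OF H K _ this] show ?thesis
    using dominated_lin_op[OF H K u(1) ub] dominated_lin_op[OF H K u(2) ub]
    by (simp add: left_diff_distrib)
qed

text \<open>
  The assumption \<open>cmp\<close> says that \<open>J\<close> preserves every two-sided bound that holds for the differences of
  all the linear operators with kernels in \<open>\<K>\<close>. It allows two base points: with equal points it yields
  comparison with the extremal operators, with equal functions it yields continuity. Suprema and
  infima both have this property, so they are treated alike.
\<close>

lemma elliptic_opsI:
  fixes J :: "'n::finite operator"
  assumes H: "dominating_kernel \<LL> H" and sub: "\<K> \<subseteq> \<LL>"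
    and def: "\<And>u x. u \<in> C11_at x \<Longrightarrow> u \<in> bounded_functions \<Longrightarrow> J u x \<noteq> None"
    and cmp: "\<And>u v x y P Q. u \<in> C11_at x \<Longrightarrow> u \<in> bounded_functions \<Longrightarrow>
        v \<in> C11_at y \<Longrightarrow> v \<in> bounded_functions \<Longrightarrow>
        (\<And>K. K \<in> \<K> \<Longrightarrow> the (lin_op K u x) - the (lin_op K v y) \<in> {Q..P}) \<Longrightarrow>
        the (J u x) - the (J v y) \<in> {Q..P}"
  shows "J \<in> elliptic_ops \<LL>"
  unfolding elliptic_ops_def
proof (intro CollectI conjI allI ballI impI)
  fix x and u :: "real ^ 'n \<Rightarrow> real" assume "u \<in> C11_at x \<inter> bounded_functions"
  then show "J u x \<noteq> None" using def by blast
next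
  fix \<Omega> and u :: "real ^ 'n \<Rightarrow> real" assume "open \<Omega>" and u: "u \<in> C11_on \<Omega> \<inter> bounded_functions"
  show "continuous_on \<Omega> (\<lambda>x. the (J u x))"
    unfolding continuous_on_sequentially comp_def
  proof (intro allI ballI impI, elim conjE)
    fix X x assume x: "x \<in> \<Omega>" and X: "\<forall>n. X n \<in> \<Omega>" "X \<longlonglongrightarrow> x"
    define F where "F k = (\<integral>y. \<bar>mu 1 u (X k) y - mu 1 u x y\<bar> * H y \<partial>lebesgue)" for k
    have F: "F \<longlonglongrightarrow> 0"
      unfolding F_def using mu_weighted_L1_continuous[OF H \<open>open \<Omega>\<close> _ _ x X(2)] u by blast
    have "the (J u (X k)) - the (J u x) \<in> {- F k..F k}" for k
    proof (rule cmp)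
      show at: "u \<in> C11_at (X k)" "u \<in> C11_at x" and ub: "u \<in> bounded_functions" "u \<in> bounded_functions"
        using u x X(1) C11_on_at by blast+
      show "the (lin_op K u (X k)) - the (lin_op K u x) \<in> {- F k..F k}" if "K \<in> \<K>" for K
        using lin_op_dist_le[OF H _ ub(1) at(2,1), of K] sub that
        by (auto simp: F_def abs_le_iff minus_le_iff)
    qed
    then have "norm (the (J u (X k)) - the (J u x)) \<le> F k" for k
      unfolding atLeastAtMost_iff real_norm_def abs_le_iff by (metis minus_le_iff)
    then have "(\<lambda>k. the (J u (X k)) - the (J u x)) \<longlonglongrightarrow> 0"
      by (intro Lim_null_comparison[OF _ F] always_eventually) blast
    then show "(\<lambda>k. the (J u (X k))) \<longlonglongrightarrow> the (J u x)" by (rule LIM_zero_cancel)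
  qed
next
  fix x and u v :: "real ^ 'n \<Rightarrow> real" assume u: "u \<in> C11_at x \<inter> bounded_functions" and v: "v \<in> C11_at x \<inter> bounded_functions"
  let ?w = "\<lambda>z. u z - v z"
  have w: "?w \<in> C11_at x" "?w \<in> bounded_functions"
    using u v C11_at_diff(1) bounded_functions_diff by blast+
  have "the (J u x) - the (J v x) \<in> {the (M_minus \<LL> 1 ?w x)..the (M_plus \<LL> 1 ?w x)}"
  proof (rule cmp)
    fix K assume "K \<in> \<K>"
    then have K: "K \<in> \<LL>" using sub by blast
    show "the (lin_op K u x) - the (lin_op K v x) \<in> {the (M_minus \<LL> 1 ?w x)..the (M_plus \<LL> 1 ?w x)}"
      using dominated_lin_op_M[OF H K w] dominated_lin_op_diff[OF H K, of u x v] u v by simp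
  qed (use u v in auto)
  then show "the (M_minus \<LL> 1 ?w x) \<le> the (J u x) - the (J v x)"
    and "the (J u x) - the (J v x) \<le> the (M_plus \<LL> 1 ?w x)" by auto
qed

lemma cSUP_diff_bounds:
  fixes f g :: "'i \<Rightarrow> real"
  assumes "I \<noteq> {}" "bdd_above (f ` I)" "bdd_above (g ` I)" "\<And>i. i \<in> I \<Longrightarrow> f i - g i \<in> {Q..P}"
  shows "(SUP i\<in>I. f i) - (SUP i\<in>I. g i) \<in> {Q..P}"
proof -
  have "f i \<le> (SUP i\<in>I. g i) + P" "g i \<le> (SUP i\<in>I. f i) - Q" if "i \<in> I" for i
    using cSUP_upper[OF that assms(2)] cSUP_upper[OF that assms(3)] assms(4)[OF that] by auto
  then have "(SUP i\<in>I. f i) \<le> (SUP i\<in>I. g i) + P" "(SUP i\<in>I. g i) \<le> (SUP i\<in>I. f i) - Q"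
    using \<open>I \<noteq> {}\<close> by (auto intro!: cSUP_least)
  then show ?thesis by auto
qed

lemma cINF_diff_bounds:
  fixes f g :: "'i \<Rightarrow> real"
  assumes "I \<noteq> {}" "bdd_below (f ` I)" "bdd_below (g ` I)" "\<And>i. i \<in> I \<Longrightarrow> f i - g i \<in> {Q..P}"
  shows "(INF i\<in>I. f i) - (INF i\<in>I. g i) \<in> {Q..P}"
proof -
  have "(INF i\<in>I. g i) + Q \<le> f i" "(INF i\<in>I. f i) - P \<le> g i" if "i \<in> I" for i
    using cINF_lower[OF assms(2) that] cINF_lower[OF assms(3) that] assms(4)[OF that] by auto
  then have "(INF i\<in>I. g i) + Q \<le> (INF i\<in>I. f i)" "(INF i\<in>I. f i) - P \<le> (INF i\<in>I. g i)"
    using \<open>I \<noteq> {}\<close> by (auto intro!: cINF_greatest)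
  then show ?thesis by auto
qed

lemma sup_inf_op_elliptic:
  fixes \<LL> :: "(real ^ 'n \<Rightarrow> real) set" and I :: "'i set"
  assumes H: "dominating_kernel \<LL> H" and "I \<noteq> {}" and K: "\<And>\<alpha>. \<alpha> \<in> I \<Longrightarrow> K \<alpha> \<in> \<LL>"
  shows "sup_op I (\<lambda>\<alpha>. lin_op (K \<alpha>)) \<in> elliptic_ops \<LL>"
    and "inf_op I (\<lambda>\<alpha>. lin_op (K \<alpha>)) \<in> elliptic_ops \<LL>"
proof -
  have bdd: "bdd_above ((\<lambda>\<alpha>. the (lin_op (K \<alpha>) u x)) ` I)" "bdd_below ((\<lambda>\<alpha>. the (lin_op (K \<alpha>) u x)) ` I)"
    and def: "\<forall>\<alpha>\<in>I. lin_op (K \<alpha>) u x \<noteq> None"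
    if u: "u \<in> C11_at x" "u \<in> bounded_functions" for u x
  proof -
    obtain A where "\<And>\<alpha>. \<alpha> \<in> I \<Longrightarrow> \<bar>the (lin_op (K \<alpha>) u x)\<bar> \<le> A"
      using dominated_lin_op_bdd[OF H u] K by blast
    then show "bdd_above ((\<lambda>\<alpha>. the (lin_op (K \<alpha>) u x)) ` I)" "bdd_below ((\<lambda>\<alpha>. the (lin_op (K \<alpha>) u x)) ` I)"
      unfolding abs_le_iff by (auto intro!: bdd_aboveI2[of _ _ A] bdd_belowI2[of _ "- A"] simp: minus_le_iff)
    show "\<forall>\<alpha>\<in>I. lin_op (K \<alpha>) u x \<noteq> None" using dominated_lin_op(2)[OF H K u] by auto
  qed
  have sup: "sup_op I (\<lambda>\<alpha>. lin_op (K \<alpha>)) u x = Some (SUP \<alpha>\<in>I. the (lin_op (K \<alpha>) u x))"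
    and inf: "inf_op I (\<lambda>\<alpha>. lin_op (K \<alpha>)) u x = Some (INF \<alpha>\<in>I. the (lin_op (K \<alpha>) u x))"
    if "u \<in> C11_at x" "u \<in> bounded_functions" for u x
    unfolding sup_op_def inf_op_def using bdd[OF that] def[OF that] by simp_all
  show "sup_op I (\<lambda>\<alpha>. lin_op (K \<alpha>)) \<in> elliptic_ops \<LL>"
  proof (rule elliptic_opsI[OF H, of "K ` I"])
    fix u v :: "real ^ 'n \<Rightarrow> real" and x y P Q
    assume u: "u \<in> C11_at x" "u \<in> bounded_functions" and v: "v \<in> C11_at y" "v \<in> bounded_functions"
      and "\<And>K'. K' \<in> K ` I \<Longrightarrow> the (lin_op K' u x) - the (lin_op K' v y) \<in> {Q..P}"
    then show "the (sup_op I (\<lambda>\<alpha>. lin_op (K \<alpha>)) u x) - the (sup_op I (\<lambda>\<alpha>. lin_op (K \<alpha>)) v y) \<in> {Q..P}"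
      unfolding sup[OF u] sup[OF v] option.sel by (intro cSUP_diff_bounds bdd \<open>I \<noteq> {}\<close>) auto
  qed (use K sup in auto)
  show "inf_op I (\<lambda>\<alpha>. lin_op (K \<alpha>)) \<in> elliptic_ops \<LL>"
  proof (rule elliptic_opsI[OF H, of "K ` I"])
    fix u v :: "real ^ 'n \<Rightarrow> real" and x y P Q
    assume u: "u \<in> C11_at x" "u \<in> bounded_functions" and v: "v \<in> C11_at y" "v \<in> bounded_functions"
      and "\<And>K'. K' \<in> K ` I \<Longrightarrow> the (lin_op K' u x) - the (lin_op K' v y) \<in> {Q..P}"
    then show "the (inf_op I (\<lambda>\<alpha>. lin_op (K \<alpha>)) u x) - the (inf_op I (\<lambda>\<alpha>. lin_op (K \<alpha>)) v y) \<in> {Q..P}"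
      unfolding inf[OF u] inf[OF v] option.sel by (intro cINF_diff_bounds bdd \<open>I \<noteq> {}\<close>) auto
  qed (use K inf in auto)
qed

section \<open>Changing the truncation radius\<close>

definition annulus :: "real \<Rightarrow> (real ^ 'n) set" where
  "annulus R = ball 0 1 - ball 0 R"

definition annular_part :: "real \<Rightarrow> real ^ 'n \<Rightarrow> real ^ 'n \<Rightarrow> real ^ 'n \<Rightarrow> real" where
  "annular_part R x p z = (p \<bullet> (z - x)) * indicator (annulus R) (z - x)"

lemma annular_part_near: "norm y < R \<Longrightarrow> annular_part R x p (x + y) = 0"
  by (simp add: annular_part_def annulus_def)

lemma C11_annular_part:
  fixes x p :: "real ^ 'n"
  assumes "0 < R"
  shows "annular_part R x p \<in> C11_at x" and "grad (annular_part R x p) x = 0"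
    and "annular_part R x p x = 0"
proof -
  show x: "annular_part R x p x = 0" using annular_part_near[of 0 R x p] assms by simp
  then have "\<bar>annular_part R x p (x + y) - annular_part R x p x - 0 \<bullet> y\<bar> \<le> 1 * (norm y)\<^sup>2"
    if "norm y < R" for y
    using that by (simp add: annular_part_near)
  from C11_atI[OF assms this] show "annular_part R x p \<in> C11_at x" "grad (annular_part R x p) x = 0"
    by auto
qed

lemma annular_part_bounded: "annular_part R x p \<in> bounded_functions"
proof (rule bounded_functionsI)
  have "{z. z - x \<in> annulus R} = ball x 1 - ball x R"
    by (auto simp: annulus_def dist_norm norm_minus_commute)
  then have [measurable]: "{z. z - x \<in> annulus R} \<in> sets borel" by simp
  have "annular_part R x p = (\<lambda>z. (p \<bullet> (z - x)) * indicator {z. z - x \<in> annulus R} z)"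
    by (auto simp: annular_part_def indicator_def)
  also have "\<dots> \<in> borel_measurable borel" by measurable
  finally show "annular_part R x p \<in> borel_measurable lebesgue" by (rule borel_measurable_lebesgueI)
  fix z
  show "\<bar>annular_part R x p z\<bar> \<le> norm p"
  proof (cases "z - x \<in> annulus R")
    case True
    then have "\<bar>p \<bullet> (z - x)\<bar> \<le> norm p * 1"
      by (intro order_trans[OF Cauchy_Schwarz_ineq2] mult_left_mono) (auto simp: annulus_def)
    then show ?thesis using True by (simp add: annular_part_def)
  qed (simp add: annular_part_def)
qed

text \<open>
  Adding back the linear part on the annulus converts the cutoff radius \<open>1\<close> in \<open>mu\<close> into \<open>R\<close>.
\<close>

definition retruncated :: "real \<Rightarrow> real ^ 'n \<Rightarrow> (real ^ 'n \<Rightarrow> real) \<Rightarrow> real ^ 'n \<Rightarrow> real" where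
  "retruncated R x u z = u z + annular_part R x (grad u x) z"

lemma retruncated_C11:
  fixes u :: "real ^ 'n \<Rightarrow> real"
  assumes "0 < R" "u \<in> C11_at x" "u \<in> bounded_functions"
  shows "retruncated R x u \<in> C11_at x" "retruncated R x u \<in> bounded_functions" "grad (retruncated R x u) x = grad u x"
proof -
  have eq: "retruncated R x u = (\<lambda>z. u z + 1 * annular_part R x (grad u x) z)"
    by (simp add: retruncated_def[abs_def])
  show "retruncated R x u \<in> C11_at x" "grad (retruncated R x u) x = grad u x"
    unfolding eq using C11_at_lincomb[OF assms(2) C11_annular_part(1)[OF assms(1)], of 1]
    by (auto simp: C11_annular_part(2)[OF assms(1)])
  have "range (retruncated R x u) = range (\<lambda>z. u z + annular_part R x (grad u x) z)"
    by (simp add: retruncated_def)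
  moreover have "bounded \<dots>"
    using assms(3) annular_part_bounded by (intro bounded_plus_comp) (auto simp: bounded_functions_def)
  moreover have "retruncated R x u \<in> borel_measurable lebesgue"
    unfolding retruncated_def[abs_def]
    by (rule borel_measurable_add[OF bounded_functionsD(1)[OF assms(3)] bounded_functionsD(1)[OF annular_part_bounded]])
  ultimately show "retruncated R x u \<in> bounded_functions" by (simp add: bounded_functions_def)
qed

lemma mu_retruncated:
  fixes u :: "real ^ 'n \<Rightarrow> real"
  assumes "0 < R" "R \<le> 1" "u \<in> C11_at x" "u \<in> bounded_functions"
  shows "mu 1 (retruncated R x u) x y = mu R u x y"
  using assms
  by (auto simp: mu_def retruncated_C11(3) retruncated_def C11_annular_part(3) annular_part_def annulus_def indicator_def)

lemma lin_op_retruncated: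
  fixes u :: "real ^ 'n \<Rightarrow> real"
  assumes "0 < R" "R \<le> 1" "u \<in> C11_at x" "u \<in> bounded_functions"
  shows "lin_op K (retruncated R x u) x = lin_op_R R K u x"
  using C11_at_differentiable[OF assms(3)] C11_at_differentiable[OF retruncated_C11(1)[OF assms(1,3,4)]]
  by (simp add: lin_op_R_def mu_retruncated[OF assms])

lemma M_retruncated:
  fixes u :: "real ^ 'n \<Rightarrow> real"
  assumes "0 < R" "R \<le> 1" "u \<in> C11_at x" "u \<in> bounded_functions"
  shows "M_plus \<LL> 1 (retruncated R x u) x = M_plus \<LL> R u x"
    and "M_minus \<LL> 1 (retruncated R x u) x = M_minus \<LL> R u x"
  by (simp_all add: M_plus_def M_minus_def sup_op_def inf_op_def lin_op_retruncated[OF assms])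

lemma sphere_measure_pos: "0 < sphere_measure (sphere 0 1 :: (real ^ 'n) set)"
proof -
  have eq: "{t *\<^sub>R \<nu> |t \<nu>. 0 < t \<and> t \<le> 1 \<and> \<nu> \<in> sphere 0 1} = cball 0 1 - {0 :: real ^ 'n}"
  proof (intro set_eqI iffI)
    fix z :: "real ^ 'n" assume z: "z \<in> cball 0 1 - {0}"
    then have "z = norm z *\<^sub>R (z /\<^sub>R norm z)" "0 < norm z" "norm z \<le> 1" "z /\<^sub>R norm z \<in> sphere 0 1"
      by auto
    then show "z \<in> {t *\<^sub>R \<nu> |t \<nu>. 0 < t \<and> t \<le> 1 \<and> \<nu> \<in> sphere 0 1}" by blast
  qed auto
  have "measure lebesgue (cball 0 1 - {0 :: real ^ 'n}) = measure lebesgue (cball 0 1 :: (real ^ 'n) set)"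
    by (rule measure_negligible_symdiff) (auto intro: negligible_subset[of "{0}"])
  also have "\<dots> > 0" by (simp add: content_cball_pos)
  finally show ?thesis unfolding sphere_measure_def eq by simp
qed

text \<open>
  Negative on the whole sphere, hence a drift function for every \<open>\<eta>\<close>.
\<close>

lemma drift_fun_neg_norm:
  assumes "0 < \<eta>" "\<eta> \<le> 1" "0 < c"
  shows "drift_fun \<eta> (\<lambda>z :: real ^ 'n. - (c * norm z))"
proof -
  have "{\<nu> \<in> sphere (0 :: real ^ 'n) 1. - (c * norm \<nu>) < 0} = sphere 0 1" using assms by auto
  then show ?thesis
    using assms sphere_measure_pos[where 'n = 'n] unfolding drift_fun_def by simp
qed

lemma elliptic_ops_defined:
  fixes J :: "'n::finite operator"
  assumes "J \<in> elliptic_ops \<LL>" "u \<in> C11_at x" "u \<in> bounded_functions"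
  shows "J u x \<noteq> None"
proof -
  have "\<forall>u \<in> C11_at x \<inter> bounded_functions. J u x \<noteq> None"
    using assms(1) unfolding elliptic_ops_def by (elim CollectE conjE) (rule spec)
  then show ?thesis using assms(2,3) by blast
qed

lemma elliptic_ops_comparison:
  fixes J :: "'n::finite operator"
  assumes "J \<in> elliptic_ops \<LL>"
    and u: "u \<in> C11_at x" "u \<in> bounded_functions" and v: "v \<in> C11_at x" "v \<in> bounded_functions"
  shows "the (M_minus \<LL> 1 (\<lambda>z. u z - v z) x) \<le> the (J u x) - the (J v x)"
    and "the (J u x) - the (J v x) \<le> the (M_plus \<LL> 1 (\<lambda>z. u z - v z) x)"
proof -
  have "\<forall>u \<in> C11_at x \<inter> bounded_functions. \<forall>v \<in> C11_at x \<inter> bounded_functions.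
      the (M_minus \<LL> 1 (\<lambda>z. u z - v z) x) \<le> the (J u x) - the (J v x) \<and>
      the (J u x) - the (J v x) \<le> the (M_plus \<LL> 1 (\<lambda>z. u z - v z) x)"
    using assms(1) unfolding elliptic_ops_def by (elim CollectE conjE) (rule spec)
  from bspec[OF bspec[OF this IntI[OF u]] IntI[OF v]]
  show "the (M_minus \<LL> 1 (\<lambda>z. u z - v z) x) \<le> the (J u x) - the (J v x)"
    and "the (J u x) - the (J v x) \<le> the (M_plus \<LL> 1 (\<lambda>z. u z - v z) x)" by blast+
qed

text \<open>
  Ellipticity compares \<open>J\<close> at the retruncated function with \<open>J\<close> at \<open>0\<close>, through the extremal operators
  with cutoff radius \<open>R\<close>. The bound \<open>cut\<close> returns from the retruncated function to \<open>u\<close>. The drift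
  \<open>- (2 - \<sigma>) R\<^sup>1\<^sup>-\<^sup>\<sigma> |z|\<close> consumes one of the \<open>A + 1\<close> units of the gradient term and leaves \<open>A\<close> of them
  for \<open>cut\<close>.
\<close>

lemma elliptic_ops_etaI:
  fixes \<LL> :: "(real ^ 'n \<Rightarrow> real) set"
  assumes J: "J \<in> elliptic_ops \<LL>" and "\<sigma> < 2" and eta: "0 < \<eta>" "\<eta> \<le> 1"
    and cut: "\<And>R x u. 0 < R \<Longrightarrow> R \<le> 1 \<Longrightarrow> u \<in> C11_at x \<Longrightarrow> u \<in> bounded_functions \<Longrightarrow>
      \<bar>the (J u x) - the (J (retruncated R x u) x)\<bar> \<le> (2 - \<sigma>) * A * R powr (1 - \<sigma>) * norm (grad u x)"
  shows "J \<in> elliptic_ops_eta \<sigma> \<LL> \<eta>"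
  unfolding elliptic_ops_eta_def
proof (intro CollectI conjI exI[of _ "A + 1"] allI impI, goal_cases)
  case 1 show ?case by fact
next
  case (2 R)
  define c where "c = (2 - \<sigma>) * R powr (1 - \<sigma>)"
  have c: "0 < c" using 2 \<open>\<sigma> < 2\<close> by (simp add: c_def)
  let ?B = "\<lambda>z :: real ^ 'n. - (c * norm z)"
  show ?case
  proof (intro exI[of _ ?B] conjI ballI drift_fun_neg_norm eta c)
    fix x and u :: "real ^ 'n \<Rightarrow> real" assume "u \<in> C11_at x \<inter> bounded_functions"
    then have u: "u \<in> C11_at x" "u \<in> bounded_functions" by auto
    have R: "0 < R" "R \<le> 1" using 2 by auto
    note w = retruncated_C11[OF R(1) u]
    have zero: "(\<lambda>_. 0) \<in> (bounded_functions :: (real ^ 'n \<Rightarrow> real) set)"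
      by (simp add: bounded_functions_def)
    note elliptic_ops_comparison[OF J w(1,2) C11_at_const zero]
    then have "the (M_minus \<LL> R u x) \<le> the (J (retruncated R x u) x) - the (J (\<lambda>_. 0) x)"
      "the (J (retruncated R x u) x) - the (J (\<lambda>_. 0) x) \<le> the (M_plus \<LL> R u x)"
      by (simp_all add: M_retruncated[OF R u])
    moreover have "\<bar>the (J u x) - the (J (retruncated R x u) x)\<bar> \<le> c * A * norm (grad u x)"
      using cut[OF R u] by (simp add: c_def mult_ac)
    moreover have "(2 - \<sigma>) * (A + 1) * R powr (1 - \<sigma>) * norm (grad u x)
        = c * A * norm (grad u x) + c * norm (grad u x)"
      by (simp add: c_def algebra_simps)
    ultimately show "the (M_minus \<LL> R u x) - ?B (grad u x)
          - (2 - \<sigma>) * (A + 1) * R powr (1 - \<sigma>) * norm (grad u x)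
        \<le> the (J u x) - the (J (\<lambda>_. 0) x)"
      and "the (J u x) - the (J (\<lambda>_. 0) x)
        \<le> the (M_plus \<LL> R u x) + ?B (grad u x)
          + (2 - \<sigma>) * (A + 1) * R powr (1 - \<sigma>) * norm (grad u x)"
      by linarith+
  qed
qed

text \<open>
  Outside every ball around the origin the two integrands differ by an odd function, whose integral
  vanishes; so the truncated integrals defining the two principal values coincide. Integrability of
  the odd function follows from the existence of both principal values.
\<close>

lemma symmetric_lin_op_retruncated:
  fixes u K :: "real ^ 'n \<Rightarrow> real"
  assumes K: "symmetric_kernel K" and R: "0 < R" "R \<le> 1"
    and u: "u \<in> C11_at x" "u \<in> bounded_functions"
    and def: "lin_op K u x \<noteq> None" "lin_op K (retruncated R x u) x \<noteq> None"
  shows "lin_op K (retruncated R x u) x = lin_op K u x"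
proof -
  have [measurable]: "K \<in> borel_measurable lebesgue" and sym: "\<And>y. K (- y) = K y"
    using K by (auto simp: symmetric_kernel_def kernel_def)
  let ?f = "\<lambda>y. mu 1 u x y * K y" and ?g = "\<lambda>y. mu R u x y * K y"
  obtain l l' where l: "has_pv_integral ?f l" and l': "has_pv_integral ?g l'"
    using def unfolding lin_op_retruncated[OF R u] unfolding lin_op_R_def by (meson option.distinct(1))
  define h where "h y = (grad u x \<bullet> y) * indicator (annulus R) y * K y" for y
  have g: "?g y = ?f y + h y" for y
    using R by (auto simp: mu_def h_def annulus_def indicator_def algebra_simps)
  have "(LINT y:- ball 0 \<epsilon>|lebesgue. ?g y) = (LINT y:- ball 0 \<epsilon>|lebesgue. ?f y)" if "0 < \<epsilon>" for \<epsilon>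
  proof -
    have int: "set_integrable lebesgue (- ball 0 \<epsilon>) ?f" "set_integrable lebesgue (- ball 0 \<epsilon>) ?g"
      using l l' that by (auto simp: has_pv_integral_def)
    have "h = (\<lambda>y. ?g y - ?f y)" by (rule ext) (simp only: g add_diff_cancel_left')
    with set_integral_diff(1)[OF int(2,1)]
    have h_int: "set_integrable lebesgue (- ball 0 \<epsilon>) h" by simp
    have "(LINT y:- ball 0 \<epsilon>|lebesgue. h y) = 0"
      unfolding set_lebesgue_integral_def
    proof (rule integral_lebesgue_odd)
      show "(\<lambda>y. indicat_real (- ball 0 \<epsilon>) y *\<^sub>R h y) \<in> borel_measurable lebesgue"
        using h_int unfolding set_integrable_def by (rule borel_measurable_integrable)
      show "indicat_real (- ball 0 \<epsilon>) (- y) *\<^sub>R h (- y) = - (indicat_real (- ball 0 \<epsilon>) y *\<^sub>R h y)" for y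
        by (auto simp: h_def annulus_def indicator_def sym)
    qed
    then show ?thesis
      unfolding g set_integral_add(2)[OF int(1) h_int] by simp
  qed
  then have "\<forall>\<^sub>F \<epsilon> in at_right 0. (LINT y:- ball 0 \<epsilon>|lebesgue. ?g y) = (LINT y:- ball 0 \<epsilon>|lebesgue. ?f y)"
    unfolding eventually_at_right_field by (intro exI[of _ 1]) simp
  then have "((\<lambda>\<epsilon>. LINT y:- ball 0 \<epsilon>|lebesgue. ?f y) \<longlongrightarrow> l') (at_right 0)"
    using l' unfolding has_pv_integral_def by (elim conjE) (erule (1) Lim_transform_eventually)
  then have "l' = l"
    using l unfolding has_pv_integral_def
    by (elim conjE) (rule tendsto_unique[OF trivial_limit_at_right_real])
  have the: "(THE l. has_pv_integral f l) = l" if "has_pv_integral f l" for f :: "real ^ 'n \<Rightarrow> real" and l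
    using that has_pv_integral_unique by (intro the_equality) auto
  show ?thesis
    unfolding lin_op_retruncated[OF R u] unfolding lin_op_R_def
    unfolding the[OF l] the[OF l'] \<open>l' = l\<close> using l l' by auto
qed

section \<open>The class with kernels comparable to \<open>|y|\<^sup>-\<^sup>n\<^sup>-\<^sup>\<sigma>\<close>\<close>

lemma dyadic_scale:
  fixes t R :: real
  assumes "0 < R" "R \<le> t"
  obtains k :: nat where "2 ^ k * R \<le> t" "t < 2 ^ Suc k * R"
proof -
  define m where "m = (LEAST m. t < 2 ^ m * R)"
  obtain m0 :: nat where "t / R < 2 ^ m0" using real_arch_pow[of 2 "t / R"] by auto
  then have "t < 2 ^ m0 * R" using assms by (simp add: field_simps)
  then have m: "t < 2 ^ m * R" unfolding m_def by (rule LeastI)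
  then obtain k where k: "m = Suc k" using assms by (cases m) auto
  then have "\<not> t < 2 ^ k * R" using not_less_Least[of k "\<lambda>m. t < 2 ^ m * R"] by (simp add: m_def)
  then show thesis using m k that[of k] by simp
qed

text \<open>
  On the dyadic shell \<open>2\<^sup>k R \<le> |y| < 2\<^sup>k\<^sup>+\<^sup>1 R\<close> the integrand is at most its value at the inner radius, and
  the shell lies in a ball of volume \<open>V (2\<^sup>k\<^sup>+\<^sup>1 R)\<^sup>n\<close>. The contributions form a geometric series of
  ratio \<open>2\<^sup>-\<^sup>s\<close>.
\<close>

lemma nn_integral_powr_tail:
  fixes s R :: real
  assumes "0 < s" "0 < R"
  defines "V \<equiv> unit_ball_vol (real CARD('n::finite))"
  shows "(\<integral>\<^sup>+y. ennreal (indicator (- ball 0 R) (y :: real ^ 'n) * norm y powr (- real CARD('n) - s)) \<partial>lebesgue)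
      \<le> ennreal (V * 2 ^ CARD('n) / (1 - 2 powr - s) * R powr - s)"
proof -
  let ?n = "CARD('n)"
  define q where "q k = 2 ^ k * R" for k :: nat
  have q: "0 < q k" for k using assms by (simp add: q_def)
  have V: "0 \<le> V" unfolding V_def by simp
  have ball_sets: "ball (0 :: real ^ 'n) r \<in> sets lebesgue" for r by simp
  have "(\<integral>\<^sup>+y. ennreal (indicator (- ball 0 R) (y :: real ^ 'n) * norm y powr (- real ?n - s)) \<partial>lebesgue)
      \<le> (\<integral>\<^sup>+y. (\<Sum>k. ennreal (q k powr (- real ?n - s)) * indicator (ball (0 :: real ^ 'n) (2 * q k)) y) \<partial>lebesgue)"
  proof (rule nn_integral_mono)
    fix y :: "real ^ 'n"
    let ?S = "\<lambda>k. ennreal (q k powr (- real ?n - s)) * indicator (ball (0 :: real ^ 'n) (2 * q k)) y"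
    show "ennreal (indicator (- ball 0 R) y * norm y powr (- real ?n - s)) \<le> (\<Sum>k. ?S k)"
    proof (cases "y \<in> ball 0 R")
      case False
      then have "R \<le> norm y" by simp
      then obtain k where "2 ^ k * R \<le> norm y" "norm y < 2 ^ Suc k * R"
        using dyadic_scale[OF \<open>0 < R\<close>] by blast
      then have k: "q k \<le> norm y" "norm y < 2 * q k" by (simp_all add: q_def mult.assoc)
      have "norm y powr (- real ?n - s) \<le> q k powr (- real ?n - s)"
        by (rule powr_mono2'[OF _ q k(1)]) (use \<open>0 < s\<close> in simp)
      then have "ennreal (indicator (- ball 0 R) y * norm y powr (- real ?n - s)) \<le> ?S k"
        using False k by (simp add: ennreal_leI)
      also have "\<dots> = sum ?S {k}"
        by (subst sum.insert) simp_all
      also have "\<dots> \<le> (\<Sum>k. ?S k)"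
        by (rule sum_le_suminf) auto
      finally show ?thesis .
    qed simp
  qed
  also have "\<dots> = (\<Sum>k. \<integral>\<^sup>+y. ennreal (q k powr (- real ?n - s)) * indicator (ball (0 :: real ^ 'n) (2 * q k)) y \<partial>lebesgue)"
    by (intro nn_integral_suminf borel_measurable_times_ennreal borel_measurable_const
        borel_measurable_indicator ball_sets)
  also have "\<dots> = (\<Sum>k. ennreal (V * 2 ^ ?n * R powr - s * (2 powr - s) ^ k))"
  proof (rule suminf_cong)
    fix k
    have "(\<integral>\<^sup>+y. ennreal (q k powr (- real ?n - s)) * indicator (ball (0 :: real ^ 'n) (2 * q k)) y \<partial>lebesgue)
        = ennreal (q k powr (- real ?n - s)) * emeasure lebesgue (ball (0 :: real ^ 'n) (2 * q k))"
      by (rule nn_integral_cmult_indicator[OF ball_sets])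
    also have "emeasure lebesgue (ball (0 :: real ^ 'n) (2 * q k)) = ennreal (V * (2 * q k) ^ ?n)"
    proof -
      have "emeasure lebesgue (ball (0 :: real ^ 'n) (2 * q k)) = emeasure lborel (ball (0 :: real ^ 'n) (2 * q k))"
        by simp
      also have "\<dots> = ennreal (V * (2 * q k) ^ ?n)"
        using emeasure_ball[of "2 * q k" "0 :: real ^ 'n"] q[of k] by (simp add: V_def)
      finally show ?thesis .
    qed
    also have "ennreal (q k powr (- real ?n - s)) * \<dots> = ennreal (q k powr (- real ?n - s) * (V * (2 * q k) ^ ?n))"
      using V q[of k] by (intro ennreal_mult[symmetric]) auto
    also have "q k powr (- real ?n - s) * (V * (2 * q k) ^ ?n) = V * 2 ^ ?n * (q k powr (- real ?n - s) * q k powr real ?n)"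
      unfolding powr_realpow[OF q] power_mult_distrib by (simp only: mult_ac)
    also have "q k powr (- real ?n - s) * q k powr real ?n = q k powr - s"
      unfolding powr_add[symmetric] by simp
    also have "q k powr - s = R powr - s * (2 powr - s) ^ k"
    proof -
      have "(2 ^ k :: real) powr - s = (2 powr - s) ^ k"
        by (induction k) (simp_all add: powr_mult)
      then show ?thesis using assms(2) by (simp add: q_def powr_mult)
    qed
    finally show "(\<integral>\<^sup>+y. ennreal (q k powr (- real ?n - s)) * indicator (ball (0 :: real ^ 'n) (2 * q k)) y \<partial>lebesgue)
        = ennreal (V * 2 ^ ?n * R powr - s * (2 powr - s) ^ k)" by (simp add: mult.assoc)
  qed
  also have "\<dots> = ennreal (V * 2 ^ ?n * R powr - s * (1 / (1 - 2 powr - s)))"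
  proof (rule suminf_ennreal_eq)
    have "2 powr - s < 1" using powr_less_mono[of "- s" 0 2] \<open>0 < s\<close> by simp
    then show "(\<lambda>k. V * 2 ^ ?n * R powr - s * (2 powr - s) ^ k) sums (V * 2 ^ ?n * R powr - s * (1 / (1 - 2 powr - s)))"
      by (intro sums_mult geometric_sums) simp
  qed (use V in simp)
  finally show ?thesis by (simp add: mult_ac)
qed

text \<open>
  The factor \<open>|y|\<close> from the linear function lowers the decay exponent of the kernel to
  \<open>n + (\<sigma> - 1)\<close>, which is still integrable at infinity exactly because \<open>\<sigma> > 1\<close>.
\<close>

lemma class_L0_annulus:
  fixes K :: "real ^ 'n \<Rightarrow> real" and p :: "real ^ 'n"
  defines "A \<equiv> unit_ball_vol (real CARD('n)) * 2 ^ CARD('n)"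
  assumes \<sigma>: "1 < \<sigma>" "\<sigma> < 2" and "0 \<le> Lam" and K: "K \<in> class_L0 lam Lam \<sigma>" and R: "0 < R"
  shows "integrable lebesgue (\<lambda>y. (p \<bullet> y) * indicator (annulus R) y * K y)"
    and "\<bar>\<integral>y. (p \<bullet> y) * indicator (annulus R) y * K y \<partial>lebesgue\<bar>
      \<le> (2 - \<sigma>) * (Lam * A / (1 - 2 powr (1 - \<sigma>))) * R powr (1 - \<sigma>) * norm p"
proof -
  let ?n = "real CARD('n)"
  let ?f = "\<lambda>y. (p \<bullet> y) * indicator (annulus R) y * K y"
  define g where "g y = indicator (- ball 0 R) y * norm y powr (- ?n - (\<sigma> - 1))" for y :: "real ^ 'n"
  define c where "c = norm p * ((2 - \<sigma>) * Lam)"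
  have [measurable]: "K \<in> borel_measurable lebesgue" and K0: "\<And>y. 0 \<le> K y"
    and Kb: "\<And>y. y \<noteq> 0 \<Longrightarrow> K y \<le> (2 - \<sigma>) * Lam * norm y powr (- ?n - \<sigma>)"
    using K by (auto simp: class_L0_def kernel_def)
  have ball_meas[measurable]: "ball (0 :: real ^ 'n) r \<in> sets borel" for r by auto
  have gm: "g \<in> borel_measurable lebesgue"
    unfolding g_def by (intro borel_measurable_lebesgueI) measurable
  have g0: "0 \<le> g y" for y by (simp add: g_def)
  define T where "T = A / (1 - 2 powr (1 - \<sigma>)) * R powr (1 - \<sigma>)"
  have g_nn: "(\<integral>\<^sup>+y. ennreal (g y) \<partial>lebesgue) \<le> ennreal T"
    using nn_integral_powr_tail[where s = "\<sigma> - 1" and R = R and 'n = 'n] \<sigma> R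
    by (simp add: g_def T_def A_def)
  have g_int: "integrable lebesgue g"
    by (rule integrableI_bounded[OF gm]) (use g_nn g0 in \<open>auto intro: le_less_trans\<close>)
  have "2 powr (1 - \<sigma>) < 1" using powr_less_mono[of "1 - \<sigma>" 0 2] \<sigma> by simp
  then have T0: "0 \<le> T" by (auto simp: T_def A_def)
  have "ennreal (\<integral>y. g y \<partial>lebesgue) \<le> ennreal T"
    using g_nn nn_integral_eq_integral[OF g_int] g0 by simp
  then have gT: "(\<integral>y. g y \<partial>lebesgue) \<le> T" using T0 by (simp add: ennreal_le_iff)
  have fg: "\<bar>?f y\<bar> \<le> c * g y" for y
  proof (cases "y \<in> annulus R")
    case True
    then have y: "y \<noteq> 0" "R \<le> norm y" using R by (auto simp: annulus_def)
    have "\<bar>?f y\<bar> = \<bar>p \<bullet> y\<bar> * K y" using True K0 by (simp add: abs_mult)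
    also have "\<dots> \<le> (norm p * norm y) * ((2 - \<sigma>) * Lam * norm y powr (- ?n - \<sigma>))"
      by (intro mult_mono Cauchy_Schwarz_ineq2 Kb y K0) auto
    also have "\<dots> = c * (norm y powr 1 * norm y powr (- ?n - \<sigma>))"
      using y by (simp add: c_def)
    also have "norm y powr 1 * norm y powr (- ?n - \<sigma>) = g y"
      unfolding powr_add[symmetric] using y by (simp add: g_def algebra_simps)
    finally show ?thesis .
  next
    case False
    then show ?thesis using \<sigma> \<open>0 \<le> Lam\<close> g0 by (simp add: c_def)
  qed
  have fm: "?f \<in> borel_measurable lebesgue"
  proof -
    have "(\<lambda>y. (p \<bullet> y) * indicator (annulus R) y) \<in> borel_measurable lebesgue"
      unfolding annulus_def by (intro borel_measurable_lebesgueI) measurable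
    then show ?thesis by measurable
  qed
  have cg_int: "integrable lebesgue (\<lambda>y. c * g y)" using g_int by simp
  show f_int: "integrable lebesgue ?f"
    by (rule Bochner_Integration.integrable_bound[OF cg_int fm])
       (auto intro: order_trans[OF fg abs_ge_self])
  have "\<bar>\<integral>y. ?f y \<partial>lebesgue\<bar> \<le> (\<integral>y. \<bar>?f y\<bar> \<partial>lebesgue)" by (rule integral_abs_bound)
  also have "\<dots> \<le> (\<integral>y. c * g y \<partial>lebesgue)"
    using f_int cg_int fg by (intro integral_mono) auto
  also have "\<dots> \<le> c * T" using gT \<sigma> \<open>0 \<le> Lam\<close> by (auto simp: c_def intro!: mult_left_mono)
  also have "\<dots> = (2 - \<sigma>) * (Lam * A / (1 - 2 powr (1 - \<sigma>))) * R powr (1 - \<sigma>) * norm p"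
    by (simp add: c_def T_def)
  finally show "\<bar>\<integral>y. ?f y \<partial>lebesgue\<bar> \<le> \<dots>" .
qed

lemma class_L0_nonempty:
  assumes "\<sigma> < 2" "0 < lam" "lam \<le> Lam"
  shows "(class_L0 lam Lam \<sigma> :: (real ^ 'n \<Rightarrow> real) set) \<noteq> {}"
proof -
  have "(\<lambda>y :: real ^ 'n. (2 - \<sigma>) * lam * norm y powr (- real CARD('n) - \<sigma>)) \<in> class_L0 lam Lam \<sigma>"
    unfolding class_L0_def kernel_def using assms
    by (auto intro!: borel_measurable_lebesgueI mult_right_mono mult_left_mono mult_nonneg_nonneg)
  then show ?thesis by blast
qed

text \<open>
  The difference \<open>a\<close> of the two functions is a linear function on the annulus and vanishes elsewhere, so
  every operator of the class maps it to an integral bounded by \<open>class_L0_annulus\<close>; ellipticity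
  transfers the bound to \<open>J\<close>.
\<close>

lemma class_L0_retruncated:
  fixes u :: "real ^ 'n \<Rightarrow> real"
  defines "A \<equiv> unit_ball_vol (real CARD('n)) * 2 ^ CARD('n)"
  assumes \<sigma>: "1 < \<sigma>" "\<sigma> < 2" and lam: "0 < lam" "lam \<le> Lam"
    and J: "J \<in> elliptic_ops (class_L0 lam Lam \<sigma>)"
    and R: "0 < R" "R \<le> 1" and u: "u \<in> C11_at x" "u \<in> bounded_functions"
  shows "\<bar>the (J u x) - the (J (retruncated R x u) x)\<bar>
      \<le> (2 - \<sigma>) * (Lam * A / (1 - 2 powr (1 - \<sigma>))) * R powr (1 - \<sigma>) * norm (grad u x)"
    (is "_ \<le> ?c")
proof -
  let ?L = "class_L0 lam Lam \<sigma> :: (real ^ 'n \<Rightarrow> real) set"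
  let ?p = "- grad u x"
  define a where "a z = u z - retruncated R x u z" for z
  note w = retruncated_C11[OF R(1) u]
  have a: "a \<in> C11_at x" and ga: "grad a x = 0"
    using C11_at_diff[OF u(1) w(1)] by (auto simp: a_def[abs_def] w(3))
  have mu_a: "mu 1 a x y = (?p \<bullet> y) * indicator (annulus R) y" for y
    by (simp add: mu_def ga a_def retruncated_def C11_annular_part(3)[OF R(1)]) (simp add: annular_part_def)
  have val: "lin_op K a x = Some (\<integral>y. (?p \<bullet> y) * indicator (annulus R) y * K y \<partial>lebesgue)"
    and val_le: "\<bar>the (lin_op K a x)\<bar> \<le> ?c" if "K \<in> ?L" for K
  proof -
    have Lam: "0 \<le> Lam" using lam by simp
    note K = class_L0_annulus[OF \<sigma> Lam that R(1), of ?p]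
    show val: "lin_op K a x = Some (\<integral>y. (?p \<bullet> y) * indicator (annulus R) y * K y \<partial>lebesgue)"
      using lin_op_integrable[OF C11_at_differentiable[OF a], of 1 K] K(1) by (simp only: mu_a)
    show "\<bar>the (lin_op K a x)\<bar> \<le> ?c"
      using K(2) unfolding val option.sel A_def norm_minus_cancel .
  qed
  have bds: "- ?c \<le> the (lin_op K a x)" "the (lin_op K a x) \<le> ?c" if "K \<in> ?L" for K
    using val_le[OF that] by linarith+
  have def: "\<forall>K\<in>?L. lin_op K a x \<noteq> None" using val by auto
  have bdd: "bdd_above ((\<lambda>K. the (lin_op K a x)) ` ?L)" "bdd_below ((\<lambda>K. the (lin_op K a x)) ` ?L)"
    using bds by (auto intro!: bdd_aboveI2[of _ _ ?c] bdd_belowI2[of _ "- ?c"])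
  note ne = class_L0_nonempty[OF \<sigma>(2) lam, where 'n = 'n]
  have "the (M_plus ?L 1 a x) \<le> ?c"
    unfolding M_plus_def sup_op_def using def bdd(1) cSUP_least[OF ne bds(2)] by simp
  moreover have "- ?c \<le> the (M_minus ?L 1 a x)"
    unfolding M_minus_def inf_op_def using def bdd(2) cINF_greatest[OF ne bds(1)] by simp
  moreover have "the (M_minus ?L 1 a x) \<le> the (J u x) - the (J (retruncated R x u) x)"
    "the (J u x) - the (J (retruncated R x u) x) \<le> the (M_plus ?L 1 a x)"
    using elliptic_ops_comparison[OF J u w(1,2)] by (simp_all add: a_def[abs_def])
  ultimately show ?thesis by linarith
qed

section \<open>Symmetric kernels and the class \<open>\<LL>\<^sub>0\<close>\<close>

theorem lemma1p1p9:
  shows "(\<forall>\<sigma> (\<LL> :: ((real ^ 'n) \<Rightarrow> real) set).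
            0 < \<sigma> \<and> \<sigma> < 2 \<and> operator_class \<LL> \<longrightarrow>
            (\<forall>K. symmetric_kernel K \<and> lin_op K \<in> elliptic_ops \<LL> \<longrightarrow>
               (\<exists>\<eta>. 0 < \<eta> \<and> \<eta> \<le> 1 \<and> lin_op K \<in> elliptic_ops_eta \<sigma> \<LL> \<eta>)) \<and>
            (\<forall>(I :: 'i set) K. I \<noteq> {} \<and> (\<forall>\<alpha>\<in>I. K \<alpha> \<in> \<LL> \<and> symmetric_kernel (K \<alpha>)) \<longrightarrow>
               (\<forall>\<eta>. 0 < \<eta> \<and> \<eta> \<le> 1 \<longrightarrow>
                  sup_op I (\<lambda>\<alpha>. lin_op (K \<alpha>)) \<in> elliptic_ops_eta \<sigma> \<LL> \<eta> \<and>
                  inf_op I (\<lambda>\<alpha>. lin_op (K \<alpha>)) \<in> elliptic_ops_eta \<sigma> \<LL> \<eta>)))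
       \<and> (\<forall>\<sigma> lam Lam. 1 < \<sigma> \<and> \<sigma> < 2 \<and> 0 < lam \<and> lam \<le> Lam \<longrightarrow>
            (\<exists>\<eta>. 0 < \<eta> \<and> \<eta> \<le> 1 \<and>
               elliptic_ops (class_L0 lam Lam \<sigma> :: ((real ^ 'n) \<Rightarrow> real) set) =
                 elliptic_ops_eta \<sigma> (class_L0 lam Lam \<sigma>) \<eta>))"
proof (intro conjI allI impI; elim conjE)
  fix \<sigma> :: real and \<LL> :: "(real ^ 'n \<Rightarrow> real) set" and K
  assume "\<sigma> < 2" and K: "symmetric_kernel K" and J: "lin_op K \<in> elliptic_ops \<LL>"
  have "lin_op K \<in> elliptic_ops_eta \<sigma> \<LL> 1"
  proof (rule elliptic_ops_etaI[OF J \<open>\<sigma> < 2\<close>, where A = 0])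
    fix R :: real and x and u :: "real ^ 'n \<Rightarrow> real"
    assume R: "0 < R" "R \<le> 1" and u: "u \<in> C11_at x" "u \<in> bounded_functions"
    have "lin_op K (retruncated R x u) x = lin_op K u x"
      using elliptic_ops_defined[OF J] u retruncated_C11(1,2)[OF R(1) u]
      by (intro symmetric_lin_op_retruncated[OF K R u])
    then show "\<bar>the (lin_op K u x) - the (lin_op K (retruncated R x u) x)\<bar>
        \<le> (2 - \<sigma>) * 0 * R powr (1 - \<sigma>) * norm (grad u x)" by simp
  qed auto
  then show "\<exists>\<eta>. 0 < \<eta> \<and> \<eta> \<le> 1 \<and> lin_op K \<in> elliptic_ops_eta \<sigma> \<LL> \<eta>"
    by (intro exI[of _ 1]) simp
next
  fix \<sigma> \<eta> :: real and \<LL> :: "(real ^ 'n \<Rightarrow> real) set" and I :: "'i set" and K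
  assume "\<sigma> < 2" and L: "operator_class \<LL>" and I: "I \<noteq> {}"
    and KI: "\<forall>\<alpha>\<in>I. K \<alpha> \<in> \<LL> \<and> symmetric_kernel (K \<alpha>)" and eta: "0 < \<eta>" "\<eta> \<le> 1"
  obtain H where H: "dominating_kernel \<LL> H" using operator_class_dominated[OF L] .
  have same: "lin_op (K \<alpha>) (retruncated R x u) x = lin_op (K \<alpha>) u x"
    if "\<alpha> \<in> I" "0 < R" "R \<le> 1" "u \<in> C11_at x" "u \<in> bounded_functions" for \<alpha> R x u
  proof (rule symmetric_lin_op_retruncated)
    have K: "K \<alpha> \<in> \<LL>" using KI that by blast
    show "lin_op (K \<alpha>) u x \<noteq> None" "lin_op (K \<alpha>) (retruncated R x u) x \<noteq> None"
      using dominated_lin_op(2)[OF H K] retruncated_C11(1,2)[OF that(2,4,5)] that(4,5) by auto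
  qed (use that KI in auto)
  have KL: "\<And>\<alpha>. \<alpha> \<in> I \<Longrightarrow> K \<alpha> \<in> \<LL>" using KI by blast
  show "sup_op I (\<lambda>\<alpha>. lin_op (K \<alpha>)) \<in> elliptic_ops_eta \<sigma> \<LL> \<eta>"
    by (rule elliptic_ops_etaI[OF sup_inf_op_elliptic(1)[OF H I KL] \<open>\<sigma> < 2\<close> eta, where A = 0])
       (auto simp: sup_op_def same)
  show "inf_op I (\<lambda>\<alpha>. lin_op (K \<alpha>)) \<in> elliptic_ops_eta \<sigma> \<LL> \<eta>"
    by (rule elliptic_ops_etaI[OF sup_inf_op_elliptic(2)[OF H I KL] \<open>\<sigma> < 2\<close> eta, where A = 0])
       (auto simp: inf_op_def same)
next
  fix \<sigma> lam Lam :: real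
  assume \<sigma>: "1 < \<sigma>" "\<sigma> < 2" and lam: "0 < lam" "lam \<le> Lam"
  let ?L = "class_L0 lam Lam \<sigma> :: (real ^ 'n \<Rightarrow> real) set"
  have "J \<in> elliptic_ops_eta \<sigma> ?L 1" if J: "J \<in> elliptic_ops ?L" for J
    by (rule elliptic_ops_etaI[OF J \<sigma>(2) _ _ class_L0_retruncated[OF \<sigma> lam J]]) auto
  then have "elliptic_ops ?L = elliptic_ops_eta \<sigma> ?L 1"
    by (auto simp: elliptic_ops_eta_def)
  then show "\<exists>\<eta>. 0 < \<eta> \<and> \<eta> \<le> 1 \<and> elliptic_ops ?L = elliptic_ops_eta \<sigma> ?L \<eta>"
    by (intro exI[of _ 1]) simp
qed

end
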